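(* Let $X=\mathrm{Sp}_{2n}(2)$ with $n\ge2$, let $\Gamma$ be an $X$-strongly incidence-transitive code in $J(\mathcal{Q}^\epsilon,k)$ and $\Delta\in\Gamma$ such that $1<|\Delta|<|\mathcal{Q}^\epsilon|-1$ and $X_\Delta$ is irreducible on $V$. Suppose that $X_\Delta\le X_{\mathcal D}$ for some decomposition $\mathcal D: V=V_1\oplus\cdots\oplus V_t$ as in the context. Then $t=2$, and either $\Gamma=\Gamma(n,n/2,+,+)$ with $\Delta=\mathcal O_0$, or $\Gamma=\Gamma(n,n/2,+,-)$ with $\Delta=\mathcal O_2$; and $X_\Delta=X_{\mathcal D}$.
   Context: $V=\mathbb{F}_2^{2n}$ with a symplectic form $B$; $X=\mathrm{Sp}_{2n}(2)$ its isometry group. $\mathcal{Q}^\epsilon$ is the set of quadratic forms $\phi:V\to\mathbb{F}_2$ of type $\epsilon\in\{+,-\}$ with $\phi(x+y)+\phi(x)+\phi(y)=B(x,y)$; $X$ acts by $\phi^g(x)=\phi(xg^{-1})$. A decomposition $\mathcal D$ is $V=V_1\oplus\cdots\oplus V_t$ with $t\ge2$, $t\mid n$, each $V_i$ nondegenerate of dimension $2n/t$, pairwise orthogonal; $X_{\mathcal D}$ is its stabiliser in $X$. $\mathcal O_m$ is the set of $\phi\in\mathcal{Q}^\epsilon$ with exactly $m$ of the restrictions $\phi|_{V_i}$ of type $-$. A code in $J(\mathcal{Q}^\epsilon,k)$ is a nonempty set of $k$-subsets of $\mathcal{Q}^\epsilon$; $X$-strongly incidence-transitive means $X$ preserves $\Gamma$,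 is transitive on it, and each $X_\Delta$ is transitive on $\Delta\times(\mathcal{Q}^\epsilon\setminus\Delta)$. Irreducible means no nonzero proper invariant subspace. For signs $\epsilon'$ (product $\epsilon\epsilon'$), $\Gamma(n,d,\epsilon,\epsilon')$ is the code whose codewords are $\{\phi\in\mathcal{Q}^\epsilon:\phi|_U$ of type $\epsilon'$, $\phi|_{U^\perp}$ of type $\epsilon\epsilon'\}$ for all nondegenerate $2d$-dimensional $U$. *)

theory Defs
  imports "HOL-Analysis.Analysis" "HOL-Library.Z2"
begin

text \<open>The field with two elements is the type \<open>bit\<close>, and the space of dimension \<open>2n\<close> over it is
  \<open>bit ^ 'm\<close> with \<open>CARD('m) = 2 * n\<close>.\<close>

definition symplectic_form :: "(bit ^ 'm \<Rightarrow> bit ^ 'm \<Rightarrow> bit) \<Rightarrow> bool" where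
  "symplectic_form B \<longleftrightarrow>
     (\<forall>x. Vector_Spaces.linear (*s) (*) (\<lambda>y. B x y)) \<and>
     (\<forall>y. Vector_Spaces.linear (*s) (*) (\<lambda>x. B x y)) \<and>
     (\<forall>x. B x x = 0) \<and>
     (\<forall>x. (\<forall>y. B x y = 0) \<longrightarrow> x = 0)"

definition nondegenerate_subspace ::
  "(bit ^ 'm \<Rightarrow> bit ^ 'm \<Rightarrow> bit) \<Rightarrow> (bit ^ 'm) set \<Rightarrow> bool" where
  "nondegenerate_subspace B U \<longleftrightarrow>
     vec.subspace U \<and> (\<forall>x\<in>U. (\<forall>y\<in>U. B x y = 0) \<longrightarrow> x = 0)"

definition perp :: "(bit ^ 'm \<Rightarrow> bit ^ 'm \<Rightarrow> bit) \<Rightarrow> (bit ^ 'm) set \<Rightarrow> (bit ^ 'm) set" where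
  "perp B U = {x. \<forall>y\<in>U. B x y = 0}"

definition Sp :: "(bit ^ 'm \<Rightarrow> bit ^ 'm \<Rightarrow> bit) \<Rightarrow> (bit ^ 'm \<Rightarrow> bit ^ 'm) set" where
  "Sp B = {g. Vector_Spaces.linear (*s) (*s) g \<and> bij g \<and> (\<forall>x y. B (g x) (g y) = B x y)}"

definition irreducible_on_space :: "(bit ^ 'm \<Rightarrow> bit ^ 'm) set \<Rightarrow> bool" where
  "irreducible_on_space H \<longleftrightarrow>
     \<not> (\<exists>U. vec.subspace U \<and> U \<noteq> {0} \<and> U \<noteq> UNIV \<and> (\<forall>g\<in>H. g ` U \<subseteq> U))"

definition quadratic_form ::
  "(bit ^ 'm \<Rightarrow> bit ^ 'm \<Rightarrow> bit) \<Rightarrow> (bit ^ 'm \<Rightarrow> bit) \<Rightarrow> bool" where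
  "quadratic_form B \<phi> \<longleftrightarrow>
     (\<forall>c x. \<phi> (c *s x) = c\<^sup>2 * \<phi> x) \<and>
     (\<forall>x y. \<phi> (x + y) + \<phi> x + \<phi> y = B x y)"

definition witt_index :: "(bit ^ 'm \<Rightarrow> bit) \<Rightarrow> (bit ^ 'm) set \<Rightarrow> nat" where
  "witt_index \<phi> U = Max {vec.dim W | W. vec.subspace W \<and> W \<subseteq> U \<and> (\<forall>x\<in>W. \<phi> x = 0)}"

datatype sign = Plus | Minus

fun sign_mult :: "sign \<Rightarrow> sign \<Rightarrow> sign" where
  "sign_mult Plus s = s"
| "sign_mult Minus Plus = Minus"
| "sign_mult Minus Minus = Plus"

text \<open>The type of the restriction of \<open>\<phi>\<close> to a nondegenerate subspace \<open>U\<close> of dimension \<open>2m\<close>: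
  \<open>+\<close> if its Witt index is \<open>m\<close>, and \<open>-\<close> if its Witt index is \<open>m - 1\<close>.\<close>

fun has_type_on :: "(bit ^ 'm \<Rightarrow> bit) \<Rightarrow> (bit ^ 'm) set \<Rightarrow> sign \<Rightarrow> bool" where
  "has_type_on \<phi> U Plus \<longleftrightarrow> 2 * witt_index \<phi> U = vec.dim U"
| "has_type_on \<phi> U Minus \<longleftrightarrow> 2 * (witt_index \<phi> U + 1) = vec.dim U"

definition Q :: "(bit ^ 'm \<Rightarrow> bit ^ 'm \<Rightarrow> bit) \<Rightarrow> sign \<Rightarrow> (bit ^ 'm \<Rightarrow> bit) set" where
  "Q B \<epsilon> = {\<phi>. quadratic_form B \<phi> \<and> has_type_on \<phi> UNIV \<epsilon>}"

definition form_act :: "(bit ^ 'm \<Rightarrow> bit ^ 'm) \<Rightarrow> (bit ^ 'm \<Rightarrow> bit) \<Rightarrow> (bit ^ 'm \<Rightarrow> bit)" where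
  "form_act g \<phi> = (\<lambda>x. \<phi> (inv g x))"

definition Sp_set_stab ::
  "(bit ^ 'm \<Rightarrow> bit ^ 'm \<Rightarrow> bit) \<Rightarrow> (bit ^ 'm \<Rightarrow> bit) set \<Rightarrow> (bit ^ 'm \<Rightarrow> bit ^ 'm) set" where
  "Sp_set_stab B \<Delta> = {g \<in> Sp B. form_act g ` \<Delta> = \<Delta>}"

definition johnson_code :: "'a set \<Rightarrow> nat \<Rightarrow> 'a set set \<Rightarrow> bool" where
  "johnson_code S k \<Gamma> \<longleftrightarrow> \<Gamma> \<noteq> {} \<and> (\<forall>\<Delta>\<in>\<Gamma>. \<Delta> \<subseteq> S \<and> card \<Delta> = k)"

definition strongly_incidence_transitive ::
  "(bit ^ 'm \<Rightarrow> bit ^ 'm \<Rightarrow> bit) \<Rightarrow> sign \<Rightarrow> (bit ^ 'm \<Rightarrow> bit) set set \<Rightarrow> bool" where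
  "strongly_incidence_transitive B \<epsilon> \<Gamma> \<longleftrightarrow>
     (\<forall>g\<in>Sp B. (\<lambda>\<Delta>. form_act g ` \<Delta>) ` \<Gamma> = \<Gamma>) \<and>
     (\<forall>\<Delta>\<in>\<Gamma>. \<forall>\<Delta>'\<in>\<Gamma>. \<exists>g\<in>Sp B. form_act g ` \<Delta> = \<Delta>') \<and>
     (\<forall>\<Delta>\<in>\<Gamma>. \<forall>(\<phi>, \<psi>) \<in> \<Delta> \<times> (Q B \<epsilon> - \<Delta>). \<forall>(\<phi>', \<psi>') \<in> \<Delta> \<times> (Q B \<epsilon> - \<Delta>).
        \<exists>g\<in>Sp_set_stab B \<Delta>. form_act g \<phi> = \<phi>' \<and> form_act g \<psi> = \<psi>')"

text \<open>The summands are \<open>V 1, \<dots>, V t\<close>; the last conjunct says that their sum is direct and is the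
  whole space.\<close>

definition decomposition ::
  "(bit ^ 'm \<Rightarrow> bit ^ 'm \<Rightarrow> bit) \<Rightarrow> nat \<Rightarrow> nat \<Rightarrow> (nat \<Rightarrow> (bit ^ 'm) set) \<Rightarrow> bool" where
  "decomposition B n t V \<longleftrightarrow>
     2 \<le> t \<and> t dvd n \<and>
     (\<forall>i\<in>{1..t}. nondegenerate_subspace B (V i) \<and> vec.dim (V i) = 2 * n div t) \<and>
     (\<forall>i\<in>{1..t}. \<forall>j\<in>{1..t}. i \<noteq> j \<longrightarrow> (\<forall>x\<in>V i. \<forall>y\<in>V j. B x y = 0)) \<and>
     (\<forall>v. \<exists>!f. f \<in> (\<Pi>\<^sub>E i\<in>{1..t}. V i) \<and> v = (\<Sum>i\<in>{1..t}. f i))"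

text \<open>The stabiliser of a decomposition may permute the summands.\<close>

definition Sp_decomp_stab ::
  "(bit ^ 'm \<Rightarrow> bit ^ 'm \<Rightarrow> bit) \<Rightarrow> nat \<Rightarrow> (nat \<Rightarrow> (bit ^ 'm) set) \<Rightarrow> (bit ^ 'm \<Rightarrow> bit ^ 'm) set" where
  "Sp_decomp_stab B t V = {g \<in> Sp B. (\<lambda>U. g ` U) ` (V ` {1..t}) = V ` {1..t}}"

definition O_set ::
  "(bit ^ 'm \<Rightarrow> bit ^ 'm \<Rightarrow> bit) \<Rightarrow> sign \<Rightarrow> nat \<Rightarrow> (nat \<Rightarrow> (bit ^ 'm) set) \<Rightarrow> nat
     \<Rightarrow> (bit ^ 'm \<Rightarrow> bit) set" where
  "O_set B \<epsilon> t V m = {\<phi> \<in> Q B \<epsilon>. card {i \<in> {1..t}. has_type_on \<phi> (V i) Minus} = m}"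

text \<open>The code \<open>\<Gamma>(n, d, \<epsilon>, \<epsilon>')\<close>; here \<open>n\<close> is determined by the type of \<open>B\<close>.\<close>

definition Gamma_code ::
  "(bit ^ 'm \<Rightarrow> bit ^ 'm \<Rightarrow> bit) \<Rightarrow> nat \<Rightarrow> sign \<Rightarrow> sign \<Rightarrow> (bit ^ 'm \<Rightarrow> bit) set set" where
  "Gamma_code B d \<epsilon> \<epsilon>' =
     {{\<phi> \<in> Q B \<epsilon>. has_type_on \<phi> U \<epsilon>' \<and> has_type_on \<phi> (perp B U) (sign_mult \<epsilon> \<epsilon>')} | U.
        nondegenerate_subspace B U \<and> vec.dim U = 2 * d}"

end

theory Submission
  imports Defs
begin

text \<open>
  The sign of the Gauss sum of \<open>(-1)^\<phi>(x)\<close> over a nondegenerate subspace is the type of \<open>\<phi>\<close> there,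
  and Gauss sums are multiplicative over orthogonal sums.  Hence the set \<open>M(\<phi>)\<close> of those \<open>i\<close> with
  \<open>\<phi>\<close> of type \<open>-\<close> on \<open>V i\<close> has cardinality of the parity prescribed by \<open>\<epsilon>\<close>, and passing from
  \<open>\<phi>\<close> to \<open>\<phi> + B(v, -)\<close> realises every set of that parity.  The stabiliser of \<open>\<Delta>\<close> has the two
  orbits \<open>\<Delta>\<close> and its complement and preserves the size of \<open>M\<close>, so there are at most two sizes and
  \<open>t \<le> 4\<close>.

  Transitivity on pairs excludes the remaining bad cases, because the relative position of
  \<open>M(\<phi>)\<close> and \<open>M(\<psi>)\<close> is an invariant of a pair: for \<open>t = 4\<close> take \<open>{1}\<close> with \<open>{1,2,3}\<close> or
  \<open>{2,3,4}\<close>; for \<open>t = 2\<close>, \<open>\<epsilon> = -\<close> irreducibility yields an element swapping the summands, so both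
  orbits contain forms with \<open>M = {1}\<close> and with \<open>M = {2}\<close>.  For \<open>t = 3\<close> the pair invariant is
  whether \<open>\<phi>\<close> and \<open>\<psi>\<close> agree on a summand; it takes both values unless the forms with
  \<open>M\<close> empty (or full) are anisotropic on all summands, and then there is only one such form.
  What is left is \<open>t = 2\<close>, \<open>\<epsilon> = +\<close>, and the code is then an \<open>Sp\<close>-orbit because \<open>Sp\<close> is transitive
  on nondegenerate subspaces of a given dimension.
\<close>

section \<open>Linear algebra over the field with two elements\<close>

instance bit :: finite
proof
  have "UNIV = {0, 1 :: bit}"
    using bit_not_zero_iff by blast
  then show "finite (UNIV :: bit set)"
    by (metis finite.emptyI finite_insert)
qed

text \<open>Bits stay in field notation, so that ring normalisation applies to them instead of
  Boolean rewriting.\<close>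

declare add_bit_eq_xor [simp del] mult_bit_eq_and [simp del]

lemma bit_add_self [simp]: "a + a = (0 :: bit)"
  by (cases a) auto

lemma bit_add_cancel [simp]: "a + (a + b) = (b :: bit)"
  by (simp flip: add.assoc)

lemma bit_vec_add_self [simp]: "x + x = (0 :: bit ^ 'm)"
  by (simp add: vec_eq_iff)

lemma bit_vec_add_cancel [simp]:
  fixes x y :: "bit ^ 'm"
  shows "x + (x + y) = y"
  by (simp flip: add.assoc)

lemma bit_vec_scale: "(c :: bit) *s (x :: bit ^ 'm) = (if c = 0 then 0 else x)"
  by (cases c) auto

lemma bit_vec_minus [simp]: "x - y = x + (y :: bit ^ 'm)"
  by (simp add: vec_eq_iff)

lemma bit_vec_add_eq_0_iff:
  fixes x y :: "bit ^ 'm"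
  shows "x + y = 0 \<longleftrightarrow> x = y"
  by (metis bit_vec_add_cancel bit_vec_add_self add_0_right)

lemma subspace_bit_iff:
  fixes U :: "(bit ^ 'm) set"
  shows "vec.subspace U \<longleftrightarrow> 0 \<in> U \<and> (\<forall>x\<in>U. \<forall>y\<in>U. x + y \<in> U)"
  by (auto simp: vec.subspace_def bit_vec_scale)

lemma sum_translate_subspace:
  fixes U :: "(bit ^ 'm) set"
  assumes "vec.subspace U" and "a \<in> U"
  shows "(\<Sum>x\<in>U. f (a + x)) = (\<Sum>x\<in>U. f x)"
  using assms
  by (intro sum.reindex_bij_witness[of _ "\<lambda>x. a + x" "\<lambda>x. a + x"]) (auto simp: subspace_bit_iff)

lemma linear_bit_iff:
  fixes f :: "bit ^ 'm \<Rightarrow> bit ^ 'k"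
  shows "Vector_Spaces.linear (*s) (*s) f \<longleftrightarrow> (\<forall>x y. f (x + y) = f x + f y)"
proof
  assume "Vector_Spaces.linear (*s) (*s) f"
  then show "\<forall>x y. f (x + y) = f x + f y"
    by (simp add: vec.linear_add)
next
  assume add: "\<forall>x y. f (x + y) = f x + f y"
  then have "f 0 = 0"
    by (metis add_cancel_right_right)
  then have "\<And>c x. f (c *s x) = c *s f x"
    by (simp add: bit_vec_scale)
  then show "Vector_Spaces.linear (*s) (*s) f"
    using add by unfold_locales auto
qed

text \<open>A new independent vector \<open>a\<close> doubles the span, which becomes the disjoint
  union of the old span and its translate by \<open>a\<close>.\<close>

lemma card_span_bit:
  fixes S :: "(bit ^ 'm) set"
  assumes "finite S" and "vec.independent S"
  shows "card (vec.span S) = 2 ^ card S"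
  using assms
proof (induction S rule: finite_induct)
  case empty
  then show ?case by simp
next
  case (insert a S)
  have a: "a \<notin> vec.span S" and ind: "vec.independent S"
    using insert.prems insert.hyps vec.independent_insert[of a S] by auto
  have eq: "vec.span (insert a S) = vec.span S \<union> (+) a ` vec.span S"
  proof (intro set_eqI)
    fix x
    have "x \<in> vec.span (insert a S) \<longleftrightarrow> (\<exists>k. x + k *s a \<in> vec.span S)"
      by (simp add: vec.span_insert)
    also have "\<dots> \<longleftrightarrow> x \<in> vec.span S \<or> x + a \<in> vec.span S"
      by (metis (full_types) add.right_neutral bit_not_zero_iff bit_vec_scale)
    also have "\<dots> \<longleftrightarrow> x \<in> vec.span S \<union> (+) a ` vec.span S"
      by (metis (no_types, lifting) Un_iff add.commute bit_vec_add_cancel image_iff)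
    finally show "x \<in> vec.span (insert a S) \<longleftrightarrow> x \<in> vec.span S \<union> (+) a ` vec.span S" .
  qed
  have "vec.span S \<inter> (+) a ` vec.span S = {}"
  proof -
    have False if "y \<in> vec.span S" "a + y \<in> vec.span S" for y
      using vec.span_add[OF that(2) that(1)] a by (simp add: add.assoc)
    then show ?thesis by blast
  qed
  then have "card (vec.span (insert a S)) = card (vec.span S) + card ((+) a ` vec.span S)"
    unfolding eq by (intro card_Un_disjoint) auto
  also have "card ((+) a ` vec.span S) = card (vec.span S)"
    by (intro card_image) (auto simp: inj_on_def)
  finally show ?case
    using insert ind by simp
qed

lemma card_subspace_bit:
  fixes U :: "(bit ^ 'm) set"
  assumes "vec.subspace U"
  shows "card U = 2 ^ vec.dim U"
  using vec.basis_subspace_exists[OF assms] card_span_bit by metis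

section \<open>The sign character and the Witt index\<close>

text \<open>The character \<open>(-1)^b\<close>, with integer values so that sums of signs can be
  compared with 0.\<close>

definition bit_sgn :: "bit \<Rightarrow> int" where
  "bit_sgn b = (if b = 0 then 1 else -1)"

lemma bit_sgn_0 [simp]: "bit_sgn 0 = 1" and bit_sgn_1 [simp]: "bit_sgn 1 = -1"
  by (auto simp: bit_sgn_def)

lemma bit_sgn_add: "bit_sgn (a + b) = bit_sgn a * bit_sgn b"
  by (cases a; cases b) auto

lemma bit_sgn_sum: "bit_sgn (\<Sum>i\<in>I. f i) = (\<Prod>i\<in>I. bit_sgn (f i))"
  by (induction I rule: infinite_finite_induct) (simp_all add: bit_sgn_add)

definition gauss_sum :: "(bit ^ 'm \<Rightarrow> bit) \<Rightarrow> (bit ^ 'm) set \<Rightarrow> int" where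
  "gauss_sum \<phi> U = (\<Sum>x\<in>U. bit_sgn (\<phi> x))"

text \<open>The zero subspace, singular because \<open>\<phi> 0 = 0\<close>, makes the set under
  \<open>Max\<close> nonempty.\<close>

lemma witt_index_attained:
  assumes U: "vec.subspace U" and 0: "\<phi> 0 = 0"
  obtains W where "vec.subspace W" "W \<subseteq> U" "\<forall>x\<in>W. \<phi> x = 0" "vec.dim W = witt_index \<phi> U"
proof -
  let ?S = "{vec.dim W | W. vec.subspace W \<and> W \<subseteq> U \<and> (\<forall>x\<in>W. \<phi> x = 0)}"
  have "vec.dim {0} \<in> ?S"
    using U 0 vec.subspace_0 by (auto simp: subspace_bit_iff intro!: exI[of _ "{0}"])
  then have "?S \<noteq> {}" by blast
  then have "Max ?S \<in> ?S"
    by (intro Max_in) auto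
  then show thesis
    using that unfolding witt_index_def by auto
qed

lemma witt_index_upper:
  assumes "vec.subspace W" "W \<subseteq> U" "\<forall>x\<in>W. \<phi> x = 0"
  shows "vec.dim W \<le> witt_index \<phi> U"
  unfolding witt_index_def using assms by (intro Max_ge) auto

section \<open>Gauss sums and the type of a quadratic form\<close>

locale symplectic_space =
  fixes B :: "bit ^ 'm \<Rightarrow> bit ^ 'm \<Rightarrow> bit"
  assumes symplectic: "symplectic_form B"
begin

lemma form_add_right: "B x (y + z) = B x y + B x z"
  using symplectic by (auto simp: symplectic_form_def Vector_Spaces.linear_iff)

lemma form_add_left: "B (x + y) z = B x z + B y z"
  using symplectic by (auto simp: symplectic_form_def Vector_Spaces.linear_iff)

lemma form_self [simp]: "B x x = 0"
  using symplectic by (auto simp: symplectic_form_def)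

lemma form_0_right [simp]: "B x 0 = 0"
  using form_add_right[of x 0 0] by simp

lemma form_0_left [simp]: "B 0 x = 0"
  using form_add_left[of 0 0 x] by simp

lemma form_sym: "B x y = B y x"
  using form_self[of "x + y"] unfolding form_add_left form_add_right
  by (cases "B x y"; cases "B y x") auto

lemma form_scale_right: "B x (c *s y) = c * B x y"
  by (auto simp: bit_vec_scale)

lemma form_scale_left: "B (c *s x) y = c * B x y"
  by (auto simp: bit_vec_scale)

lemma form_sum_right: "B x (\<Sum>i\<in>I. f i) = (\<Sum>i\<in>I. B x (f i))"
  by (induction I rule: infinite_finite_induct) (auto simp: form_add_right)

lemma form_sum_left: "B (\<Sum>i\<in>I. f i) x = (\<Sum>i\<in>I. B (f i) x)"
  by (simp add: form_sym[of _ x] form_sum_right)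

abbreviation "nondeg U \<equiv> nondegenerate_subspace B U"
abbreviation "quad \<phi> \<equiv> quadratic_form B \<phi>"

lemma nondeg_UNIV: "nondeg UNIV"
  using symplectic by (auto simp: nondegenerate_subspace_def symplectic_form_def)

lemma nondeg_subspace: "nondeg U \<Longrightarrow> vec.subspace U"
  by (simp add: nondegenerate_subspace_def)

lemma nondegD: "nondeg U \<Longrightarrow> x \<in> U \<Longrightarrow> (\<And>y. y \<in> U \<Longrightarrow> B x y = 0) \<Longrightarrow> x = 0"
  by (auto simp: nondegenerate_subspace_def)

lemma nondeg_0: "nondeg U \<Longrightarrow> 0 \<in> U"
  and nondeg_add: "nondeg U \<Longrightarrow> x \<in> U \<Longrightarrow> y \<in> U \<Longrightarrow> x + y \<in> U"
  by (auto simp: nondegenerate_subspace_def subspace_bit_iff)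

text \<open>Over two elements the scaling law amounts to \<open>\<phi> 0 = 0\<close>, and in
  characteristic 2 the polar identity can be solved for \<open>\<phi> (x + y)\<close>.\<close>

lemma quad_iff: "quad \<phi> \<longleftrightarrow> \<phi> 0 = 0 \<and> (\<forall>x y. \<phi> (x + y) = \<phi> x + \<phi> y + B x y)"
proof -
  have "(\<phi> (x + y) + \<phi> x + \<phi> y = B x y) \<longleftrightarrow> \<phi> (x + y) = \<phi> x + \<phi> y + B x y" for x y
    by (cases "\<phi> (x + y)"; cases "\<phi> x"; cases "\<phi> y"; cases "B x y") auto
  moreover have "(\<forall>c x. \<phi> (c *s x) = c\<^sup>2 * \<phi> x) \<longleftrightarrow> \<phi> 0 = 0"
  proof
    assume "\<forall>c x. \<phi> (c *s x) = c\<^sup>2 * \<phi> x"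
    from spec[OF spec[OF this, of 0], of 0] show "\<phi> 0 = 0" by simp
  qed (auto simp: bit_vec_scale)
  ultimately show ?thesis
    by (simp add: quadratic_form_def)
qed

lemma quad_0: "quad \<phi> \<Longrightarrow> \<phi> 0 = 0"
  and quad_add: "quad \<phi> \<Longrightarrow> \<phi> (x + y) = \<phi> x + \<phi> y + B x y"
  by (simp_all add: quad_iff)

lemma subspace_perp: "vec.subspace (perp B W)"
  by (auto simp: subspace_bit_iff perp_def form_add_left)

text \<open>Orthogonality of characters: if \<open>B x y = 1\<close> for some \<open>y\<close> in
  \<open>W\<close>, translation by \<open>y\<close> negates the sum.\<close>

lemma character_sum:
  assumes "vec.subspace W"
  shows "(\<Sum>w\<in>W. bit_sgn (B x w)) = (if x \<in> perp B W then int (card W) else 0)"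
proof (cases "x \<in> perp B W")
  case True
  then show ?thesis by (simp add: perp_def)
next
  case False
  then obtain y where y: "y \<in> W" "B x y = 1"
    by (auto simp: perp_def)
  have "(\<Sum>w\<in>W. bit_sgn (B x w)) = (\<Sum>w\<in>W. bit_sgn (B x (y + w)))"
    using sum_translate_subspace[OF assms y(1), of "\<lambda>w. bit_sgn (B x w)"] by simp
  also have "\<dots> = - (\<Sum>w\<in>W. bit_sgn (B x w))"
    by (simp add: form_add_right bit_sgn_add y sum_negf)
  finally show ?thesis
    using False by simp
qed

text \<open>Sum \<open>bit_sgn (B x w)\<close> over \<open>U \<times> W\<close> in both orders: the
  inner character sum survives only on \<open>perp B W\<close> in one order and, by nondegeneracy,
  only at \<open>w = 0\<close> in the other.\<close>

lemma card_perp: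
  assumes U: "nondeg U" and W: "vec.subspace W" "W \<subseteq> U"
  shows "card W * card (U \<inter> perp B W) = card U"
proof -
  have "(\<Sum>x\<in>U. \<Sum>w\<in>W. bit_sgn (B x w)) = (\<Sum>x\<in>U. if x \<in> perp B W then int (card W) else 0)"
    by (simp add: character_sum[OF W(1)])
  also have "\<dots> = int (card W * card (U \<inter> perp B W))"
    by (simp add: sum.If_cases)
  finally have 1: "(\<Sum>x\<in>U. \<Sum>w\<in>W. bit_sgn (B x w)) = int (card W * card (U \<inter> perp B W))" .
  have "(\<Sum>x\<in>U. \<Sum>w\<in>W. bit_sgn (B x w)) = (\<Sum>w\<in>W. \<Sum>x\<in>U. bit_sgn (B w x))"
    by (subst sum.swap) (simp add: form_sym)
  also have "\<dots> = (\<Sum>w\<in>W. if w = 0 then int (card U) else 0)"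
  proof (intro sum.cong refl)
    fix w assume "w \<in> W"
    then have "w \<in> perp B U \<longleftrightarrow> w = 0"
      using nondegD[OF U, of w] W(2) by (auto simp: perp_def)
    then show "(\<Sum>x\<in>U. bit_sgn (B w x)) = (if w = 0 then int (card U) else 0)"
      by (simp add: character_sum[OF nondeg_subspace[OF U]])
  qed
  also have "\<dots> = int (card U)"
    using W(1) by (simp add: subspace_bit_iff)
  finally show ?thesis
    using 1 by linarith
qed

text \<open>Substituting \<open>y = x + z\<close> in the double sum leaves a character sum over
  \<open>x\<close>, which by nondegeneracy vanishes unless \<open>z = 0\<close>.\<close>

lemma gauss_sum_square:
  assumes U: "nondeg U" and \<phi>: "quad \<phi>"
  shows "(gauss_sum \<phi> U)\<^sup>2 = int (card U)"
proof -
  have "(gauss_sum \<phi> U)\<^sup>2 = (\<Sum>x\<in>U. \<Sum>y\<in>U. bit_sgn (\<phi> x) * bit_sgn (\<phi> y))"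
    by (simp add: power2_eq_square gauss_sum_def sum_product)
  also have "\<dots> = (\<Sum>x\<in>U. \<Sum>z\<in>U. bit_sgn (\<phi> x) * bit_sgn (\<phi> (x + z)))"
    by (intro sum.cong refl sum_translate_subspace[symmetric] nondeg_subspace[OF U])
  also have "\<dots> = (\<Sum>x\<in>U. \<Sum>z\<in>U. bit_sgn (\<phi> z) * bit_sgn (B z x))"
    by (intro sum.cong refl) (auto simp: quad_add[OF \<phi>] bit_sgn_def form_sym)
  also have "\<dots> = (\<Sum>z\<in>U. bit_sgn (\<phi> z) * (\<Sum>x\<in>U. bit_sgn (B z x)))"
    by (subst sum.swap) (simp add: sum_distrib_left)
  also have "\<dots> = (\<Sum>z\<in>U. if z = 0 then int (card U) else 0)"
  proof (intro sum.cong refl)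
    fix w assume "w \<in> U"
    then have "w \<in> perp B U \<longleftrightarrow> w = 0"
      using nondegD[OF U, of w] by (auto simp: perp_def)
    then show "bit_sgn (\<phi> w) * (\<Sum>x\<in>U. bit_sgn (B w x)) = (if w = 0 then int (card U) else 0)"
      by (simp add: character_sum[OF nondeg_subspace[OF U]] quad_0[OF \<phi>])
  qed
  also have "\<dots> = int (card U)"
    by (simp add: nondeg_0[OF U])
  finally show ?thesis .
qed

text \<open>Average over translations by \<open>W\<close>: since
  \<open>\<phi> (w + x) = \<phi> x + B x w\<close> for singular \<open>w\<close>, a character sum
  appears that kills every \<open>x\<close> outside \<open>perp B W\<close>.\<close>

lemma gauss_sum_singular_subspace:
  assumes U: "nondeg U" and \<phi>: "quad \<phi>"
    and W: "vec.subspace W" "W \<subseteq> U" "\<forall>x\<in>W. \<phi> x = 0"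
  shows "gauss_sum \<phi> U = gauss_sum \<phi> (U \<inter> perp B W)"
proof -
  have "int (card W) * gauss_sum \<phi> U = (\<Sum>w\<in>W. \<Sum>x\<in>U. bit_sgn (\<phi> x))"
    by (simp add: gauss_sum_def)
  also have "\<dots> = (\<Sum>w\<in>W. \<Sum>x\<in>U. bit_sgn (\<phi> (w + x)))"
    using W(2)
    by (intro sum.cong refl sum_translate_subspace[symmetric] nondeg_subspace[OF U]) auto
  also have "\<dots> = (\<Sum>w\<in>W. \<Sum>x\<in>U. bit_sgn (\<phi> x) * bit_sgn (B x w))"
    using W by (intro sum.cong refl) (auto simp: quad_add[OF \<phi>] bit_sgn_add form_sym)
  also have "\<dots> = (\<Sum>x\<in>U. bit_sgn (\<phi> x) * (\<Sum>w\<in>W. bit_sgn (B x w)))"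
    by (subst sum.swap) (simp add: sum_distrib_left)
  also have "\<dots> = (\<Sum>x\<in>U. if x \<in> perp B W then bit_sgn (\<phi> x) * int (card W) else 0)"
    by (intro sum.cong refl) (simp add: character_sum[OF W(1)])
  also have "\<dots> = int (card W) * gauss_sum \<phi> (U \<inter> perp B W)"
    by (simp add: sum.If_cases gauss_sum_def sum_distrib_left mult.commute)
  finally show ?thesis
    using card_subspace_bit[OF W(1)] by simp
qed

text \<open>Let \<open>W\<close> be a singular subspace of maximal dimension \<open>w\<close>, of
  codimension \<open>c\<close> in its orthogonal complement within \<open>U\<close>. By maximality
  \<open>\<phi>\<close> is 1 on that complement outside \<open>W\<close>, so the Gauss sum is
  \<open>2 ^ w * (2 - 2 ^ c)\<close>. Comparing its square with
  \<open>card U = 2 ^ (2 * w + c)\<close> forces \<open>c = 0\<close> or \<open>c = 2\<close>, the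
  two alternatives.\<close>

lemma witt_index_gauss_sum:
  assumes U: "nondeg U" and \<phi>: "quad \<phi>"
  shows "2 * witt_index \<phi> U = vec.dim U \<and> gauss_sum \<phi> U > 0
    \<or> 2 * (witt_index \<phi> U + 1) = vec.dim U \<and> gauss_sum \<phi> U < 0"
proof -
  obtain W where W: "vec.subspace W" "W \<subseteq> U" "\<forall>x\<in>W. \<phi> x = 0" "vec.dim W = witt_index \<phi> U"
    using witt_index_attained[of U \<phi>] nondeg_subspace[OF U] quad_0[OF \<phi>] by blast
  let ?P = "U \<inter> perp B W"
  \<comment> \<open>On \<open>W\<close> the form \<open>B\<close> is the polarisation of the zero
    function, so \<open>W\<close> is totally isotropic.\<close>
  have WP: "W \<subseteq> ?P"
  proof -
    have "B x y = 0" if "x \<in> W" "y \<in> W" for x y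
      using quad_add[OF \<phi>, of x y] W that by (auto simp: subspace_bit_iff)
    then show ?thesis
      using W(2) by (auto simp: perp_def)
  qed
  \<comment> \<open>A singular vector outside \<open>W\<close> but orthogonal to it would enlarge \<open>W\<close>.\<close>
  have one: "\<phi> x = 1" if x: "x \<in> ?P - W" for x
  proof (rule ccontr)
    assume "\<phi> x \<noteq> 1"
    then have x0: "\<phi> x = 0" by simp
    let ?W = "vec.span (insert x W)"
    have el: "y \<in> W \<or> x + y \<in> W" if "y \<in> ?W" for y
    proof -
      have "\<exists>k. y + k *s x \<in> W"
        using that W(1) by (simp add: vec.span_insert vec.span_eq_iff[THEN iffD2])
      then show ?thesis
        by (auto simp: bit_vec_scale add.commute split: if_splits)
    qed
    have sing: "\<phi> y = 0 \<and> y \<in> U" if "y \<in> ?W" for y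
      using el[OF that]
    proof
      assume "x + y \<in> W"
      then have xy: "\<phi> (x + y) = 0" "B x (x + y) = 0" "x + y \<in> U"
        using x W(2,3) by (auto simp: perp_def)
      have "\<phi> y = \<phi> x + \<phi> (x + y) + B x (x + y)"
        using quad_add[OF \<phi>, of x "x + y"] by simp
      moreover have "y \<in> U"
        using x xy(3) nondeg_add[OF U, of x "x + y"] by simp
      ultimately show ?thesis
        using xy x0 by simp
    qed (use W in auto)
    have "vec.dim ?W \<le> vec.dim W"
      unfolding W(4) using sing by (intro witt_index_upper vec.subspace_span) auto
    moreover have "W \<subset> ?W"
      using x vec.span_superset[of "insert x W"] by auto
    then have "card W < card ?W"
      by (intro psubset_card_mono) auto
    then have "(2::nat) ^ vec.dim W < 2 ^ vec.dim ?W"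
      by (simp only: card_subspace_bit[OF W(1)] card_subspace_bit[OF vec.subspace_span])
    ultimately show False by simp
  qed
  define w where "w = vec.dim W"
  have dP: "vec.dim U = w + vec.dim ?P"
    using card_perp[OF U W(1,2)] W(1) U
    by (simp add: card_subspace_bit nondeg_subspace subspace_perp vec.subspace_inter w_def
        flip: power_add)
  obtain c where c: "vec.dim ?P = w + c"
    using vec.dim_subset[OF WP] unfolding w_def by (metis le_Suc_ex)
  have cards: "card W = 2 ^ w" "card ?P = 2 ^ (w + c)" "card U = 2 ^ (w + (w + c))"
    using c dP W(1) nondeg_subspace[OF U]
    by (simp_all add: card_subspace_bit subspace_perp vec.subspace_inter w_def)
  have "gauss_sum \<phi> U = (\<Sum>x\<in>?P. if x \<in> W then 1 else - 1)"
    unfolding gauss_sum_singular_subspace[OF U \<phi> W(1-3)] unfolding gauss_sum_def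
    using W(3) one by (intro sum.cong) auto
  also have "\<dots> = int (card W) - int (card (?P - W))"
    using WP by (simp add: sum.If_cases Int_absorb1 Diff_eq)
  also have "card (?P - W) = card ?P - card W"
    using WP by (intro card_Diff_subset) auto
  finally have "gauss_sum \<phi> U = int (card W) - int (card ?P - card W)" .
  moreover have "card W \<le> card ?P"
    using WP by (intro card_mono) auto
  ultimately have g: "gauss_sum \<phi> U = 2 ^ w * (2 - 2 ^ c)"
    by (simp add: cards of_nat_diff power_add algebra_simps)
  have "(2 ^ w)\<^sup>2 * ((2 - 2 ^ c)\<^sup>2 - 2 ^ c) = (0 :: int)"
    using gauss_sum_square[OF U \<phi>] unfolding g cards
    by (simp add: power_add power2_eq_square algebra_simps)
  then have "(2 - 2 ^ c)\<^sup>2 - 2 ^ c = (0 :: int)"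
    by simp
  \<comment> \<open>With \<open>q = 2 ^ c\<close>, the left side above is
    \<open>q^2 - 5 * q + 4\<close>.\<close>
  then have "(2 ^ c - 1) * (2 ^ c - 4) = (0 :: int)"
    by (simp add: power2_eq_square algebra_simps)
  then have "2 ^ c = (2 :: int) ^ 0 \<or> 2 ^ c = (2 :: int) ^ 2"
    by auto
  moreover have "(1 :: int) < 2"
    by simp
  ultimately have "c = 0 \<or> c = 2"
    unfolding power_inject_exp[OF \<open>(1 :: int) < 2\<close>] by blast
  then show ?thesis
    using g dP c W(4) by (auto simp: w_def)
qed

text \<open>The type becomes the sign of a Gauss sum, which is easier to transport and to multiply
  than a Witt index; in particular exactly one type holds.\<close>

lemma
  assumes "nondeg U" and "quad \<phi>"
  shows has_type_on_Plus_iff_gauss_sum: "has_type_on \<phi> U Plus \<longleftrightarrow> gauss_sum \<phi> U > 0"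
    and has_type_on_Minus_iff_gauss_sum: "has_type_on \<phi> U Minus \<longleftrightarrow> gauss_sum \<phi> U < 0"
    and has_type_on_Plus_iff: "has_type_on \<phi> U Plus \<longleftrightarrow> \<not> has_type_on \<phi> U Minus"
proof -
  have "\<not> (2 * witt_index \<phi> U = vec.dim U \<and> 2 * (witt_index \<phi> U + 1) = vec.dim U)"
    and "\<not> (gauss_sum \<phi> U < 0 \<and> 0 < gauss_sum \<phi> U)"
    by simp_all
  then show "has_type_on \<phi> U Plus \<longleftrightarrow> gauss_sum \<phi> U > 0"
    and "has_type_on \<phi> U Minus \<longleftrightarrow> gauss_sum \<phi> U < 0"
    and "has_type_on \<phi> U Plus \<longleftrightarrow> \<not> has_type_on \<phi> U Minus"
    unfolding has_type_on.simps using witt_index_gauss_sum[OF assms] by blast+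
qed

end

section \<open>The symplectic group\<close>

context symplectic_space
begin

lemma
  assumes "g \<in> Sp B"
  shows Sp_add: "g (x + y) = g x + g y"
    and Sp_bij: "bij g"
    and Sp_form: "B (g x) (g y) = B x y"
  using assms by (auto simp: Sp_def linear_bit_iff)

text \<open>Nondegeneracy makes a form-preserving additive map injective, and finiteness makes it
  bijective.\<close>

lemma SpI:
  assumes add: "\<And>x y. g (x + y) = g x + g y" and form: "\<And>x y. B (g x) (g y) = B x y"
  shows "g \<in> Sp B"
proof -
  have "inj g"
  proof (rule injI)
    fix x y assume eq: "g x = g y"
    have "B (x + y) z = 0" for z
      using form[of x z] form[of y z] eq by (simp add: form_add_left)
    then have "x + y = 0"
      by (intro nondegD[OF nondeg_UNIV]) auto
    then show "x = y"
      by (simp add: bit_vec_add_eq_0_iff)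
  qed
  then have "bij g"
    by (simp add: bij_def finite_UNIV_inj_surj)
  then show ?thesis
    using assms by (auto simp: Sp_def linear_bit_iff)
qed

lemma Sp_0: "g \<in> Sp B \<Longrightarrow> g 0 = 0"
  using Sp_add[of g 0 0] by simp

lemma form_act_apply: "g \<in> Sp B \<Longrightarrow> form_act g \<phi> (g x) = \<phi> x"
  using Sp_bij by (simp add: form_act_def bij_def)

lemma inj_form_act:
  assumes "g \<in> Sp B"
  shows "inj (form_act g)"
proof (rule injI)
  fix \<phi> \<psi> assume "form_act g \<phi> = form_act g \<psi>"
  then have "\<phi> x = \<psi> x" for x
    using form_act_apply[OF assms] by metis
  then show "\<phi> = \<psi>" by blast
qed

lemma quad_form_act:
  assumes g: "g \<in> Sp B" and \<phi>: "quad \<phi>"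
  shows "quad (form_act g \<phi>)"
  unfolding quad_iff
proof (intro conjI allI)
  show "form_act g \<phi> 0 = 0"
    using form_act_apply[OF g, of \<phi> 0] quad_0[OF \<phi>] Sp_0[OF g] by simp
next
  fix x y
  obtain x' y' where "x = g x'" "y = g y'"
    using Sp_bij[OF g] by (metis bij_pointE)
  then show "form_act g \<phi> (x + y) = form_act g \<phi> x + form_act g \<phi> y + B x y"
    using form_act_apply[OF g, of \<phi>] quad_add[OF \<phi>]
    by (simp add: Sp_form[OF g] flip: Sp_add[OF g])
qed

lemma nondeg_image:
  assumes g: "g \<in> Sp B" and U: "nondeg U"
  shows "nondeg (g ` U)"
  unfolding nondegenerate_subspace_def subspace_bit_iff
proof (intro conjI ballI impI)
  show "0 \<in> g ` U"
    using Sp_0[OF g] nondeg_0[OF U] by (metis imageI)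
  show "x + y \<in> g ` U" if "x \<in> g ` U" "y \<in> g ` U" for x y
    using that nondeg_add[OF U] by (auto simp flip: Sp_add[OF g])
  show "x = 0" if "x \<in> g ` U" "\<forall>y\<in>g ` U. B x y = 0" for x
  proof -
    from that obtain z where z: "x = g z" "z \<in> U" "\<forall>y\<in>U. B z y = 0"
      by (auto simp: Sp_form[OF g])
    then show ?thesis
      using nondegD[OF U, of z] by (simp add: Sp_0[OF g])
  qed
qed

lemma gauss_sum_form_act:
  assumes "g \<in> Sp B"
  shows "gauss_sum (form_act g \<phi>) (g ` U) = gauss_sum \<phi> U"
proof -
  have "inj_on g U"
    using Sp_bij[OF assms] by (metis bij_is_inj inj_on_subset subset_UNIV)
  then show ?thesis
    by (simp add: gauss_sum_def sum.reindex form_act_apply[OF assms])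
qed

text \<open>Gauss sums are unchanged by reindexing along \<open>g\<close>, and they determine the
  type.\<close>

lemma has_type_on_form_act:
  assumes "g \<in> Sp B" "quad \<phi>" "nondeg U"
  shows "has_type_on (form_act g \<phi>) (g ` U) s \<longleftrightarrow> has_type_on \<phi> U s"
  using assms
  by (cases s) (simp_all only: has_type_on_Plus_iff_gauss_sum has_type_on_Minus_iff_gauss_sum
      quad_form_act nondeg_image gauss_sum_form_act)

lemma quad_if_Q: "\<phi> \<in> Q B \<epsilon> \<Longrightarrow> quad \<phi>"
  by (simp add: Q_def)

lemma form_act_Q:
  assumes g: "g \<in> Sp B" and \<phi>: "\<phi> \<in> Q B \<epsilon>"
  shows "form_act g \<phi> \<in> Q B \<epsilon>"
proof -
  have "g ` UNIV = UNIV"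
    using Sp_bij[OF g] by (rule bij_is_surj)
  then show ?thesis
    using has_type_on_form_act[OF g quad_if_Q[OF \<phi>] nondeg_UNIV, of \<epsilon>] \<phi> quad_form_act[OF g]
    by (simp add: Q_def)
qed

lemma perp_image:
  assumes g: "g \<in> Sp B"
  shows "perp B (g ` U) = g ` perp B U"
proof -
  have "x \<in> g ` perp B U" if "x \<in> perp B (g ` U)" for x
  proof -
    obtain x' where "x = g x'"
      using Sp_bij[OF g] by (metis bij_pointE)
    then show ?thesis
      using that by (auto simp: perp_def Sp_form[OF g])
  qed
  then show ?thesis
    by (auto simp: perp_def Sp_form[OF g])
qed

section \<open>Orthogonal complements and Witt's theorem\<close>

lemma card_nondeg_perp:
  assumes "nondeg U"
  shows "card U * card (perp B U) = CARD(bit ^ 'm)"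
  using card_perp[OF nondeg_UNIV nondeg_subspace[OF assms]] by simp

text \<open>Addition on \<open>U \<times> perp B U\<close> is injective since the two subspaces meet
  only in 0, and by \<open>card_nondeg_perp\<close> its domain has as many elements as the whole
  space.\<close>

lemma nondeg_perp_decompose:
  assumes U: "nondeg U"
  obtains u w where "u \<in> U" "w \<in> perp B U" "x = u + w"
proof -
  let ?f = "\<lambda>(u, w). u + w"
  have "inj_on ?f (U \<times> perp B U)"
  proof (rule inj_onI, clarify)
    fix u w u' w'
    assume *: "u \<in> U" "u' \<in> U" "w \<in> perp B U" "w' \<in> perp B U" "u + w = u' + w'"
    have eq: "u + u' = w + w'"
      using *(5) by (metis (no_types, lifting) add.assoc add.commute bit_vec_add_cancel)
    have "u + u' \<in> perp B U"
      unfolding eq using * subspace_perp[of U] by (simp add: subspace_bit_iff)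
    then have "u + u' = 0"
      using nondegD[OF U nondeg_add[OF U *(1,2)]] by (simp add: perp_def)
    then show "u = u' \<and> w = w'"
      using eq bit_vec_add_eq_0_iff by metis
  qed
  then have "card (?f ` (U \<times> perp B U)) = CARD(bit ^ 'm)"
    by (simp only: card_image card_cartesian_product card_nondeg_perp[OF U])
  then have "?f ` (U \<times> perp B U) = UNIV"
    by (intro card_subset_eq) auto
  then have "x \<in> ?f ` (U \<times> perp B U)" by blast
  then show ?thesis
    using that by auto
qed

text \<open>A vector of \<open>perp B U\<close> orthogonal to \<open>perp B U\<close> is orthogonal
  to \<open>U\<close> as well, hence to the whole space.\<close>

lemma nondeg_perp:
  assumes U: "nondeg U"
  shows "nondeg (perp B U)"
  unfolding nondegenerate_subspace_def
proof (intro conjI ballI impI subspace_perp)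
  fix x assume x: "x \<in> perp B U" "\<forall>y\<in>perp B U. B x y = 0"
  show "x = 0"
  proof (rule nondegD[OF nondeg_UNIV])
    fix z
    obtain u w where "u \<in> U" "w \<in> perp B U" "z = u + w"
      using nondeg_perp_decompose[OF U] by blast
    then show "B x z = 0"
      using x by (simp add: form_add_right perp_def)
  qed simp
qed

text \<open>\<open>U\<close> is the orthogonal sum of \<open>U1\<close> and the hyperbolic plane
  spanned by \<open>e\<close> and \<open>f\<close>, which has 4 elements; \<open>p\<close> projects
  onto \<open>U1\<close>. The coefficient of \<open>e\<close> is \<open>B x f\<close> and that of
  \<open>f\<close> is \<open>B x e\<close>, because \<open>B e f = 1\<close>.\<close>

lemma hyperbolic_pair_complement:
  assumes U: "nondeg U" and e: "e \<in> U" and f: "f \<in> U" and ef: "B e f = 1"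
  defines "p \<equiv> \<lambda>x. x + B x f *s e + B x e *s f"
  defines "U1 \<equiv> {x \<in> U. B x e = 0 \<and> B x f = 0}"
  shows "nondeg U1" and "card U = 4 * card U1"
    and "\<And>x. x \<in> U \<Longrightarrow> p x \<in> U1" and "\<And>x y. p (x + y) = p x + p y"
    and "\<And>x y. B x y = B x f * B y e + B x e * B y f + B (p x) (p y)"
proof -
  have fe: "B f e = 1"
    using ef by (simp add: form_sym)
  show p_add: "p (x + y) = p x + p y" for x y
    unfolding p_def form_add_left vec.scale_left_distrib by (simp add: add_ac)
  have sc: "c *s x \<in> U" if "x \<in> U" for c x
    using that nondeg_0[OF U] by (simp add: bit_vec_scale)
  show p: "p x \<in> U1" if "x \<in> U" for x
    using that e f ef fe
    by (auto simp: U1_def p_def form_add_left form_scale_left intro!: nondeg_add[OF U] sc)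
  have sub: "vec.subspace U1"
    using nondeg_0[OF U] nondeg_add[OF U] by (auto simp: subspace_bit_iff U1_def form_add_left)
  show B_eq: "B x y = B x f * B y e + B x e * B y f + B (p x) (p y)" for x y
    using ef fe form_sym[of e y] form_sym[of f y]
    by (cases "B x f"; cases "B x e"; cases "B y e"; cases "B y f")
       (auto simp: p_def form_add_left form_add_right form_scale_left form_scale_right add_ac)
  show "nondeg U1"
    unfolding nondegenerate_subspace_def
  proof (intro conjI ballI impI sub)
    fix x assume x: "x \<in> U1" "\<forall>y\<in>U1. B x y = 0"
    have px: "p x = x"
      using x by (simp add: p_def U1_def)
    show "x = 0"
    proof (rule nondegD[OF U])
      fix y assume "y \<in> U"
      then show "B x y = 0"
        using B_eq[of x y] x px p[of y] by (auto simp: U1_def)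
    qed (use x in \<open>simp add: U1_def\<close>)
  qed
  have "bij_betw (\<lambda>(a, b, y). y + a *s e + b *s f) (UNIV \<times> UNIV \<times> U1) U"
  proof (rule bij_betw_byWitness[where f' = "\<lambda>x. (B x f, B x e, p x)"])
    show "\<forall>z\<in>UNIV \<times> UNIV \<times> U1.
      (case case z of (a, b, y) \<Rightarrow> y + a *s e + b *s f of x \<Rightarrow> (B x f, B x e, p x)) = z"
      using ef fe
      by (auto simp: U1_def form_add_left form_scale_left p_def add_ac)
    show "\<forall>x\<in>U. (case (B x f, B x e, p x) of (a, b, y) \<Rightarrow> y + a *s e + b *s f) = x"
      by (auto simp: p_def bit_vec_scale add_ac)
    show "(\<lambda>(a, b, y). y + a *s e + b *s f) ` (UNIV \<times> UNIV \<times> U1) \<subseteq> U"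
      using e f by (auto simp: U1_def intro!: nondeg_add[OF U] sc)
    show "(\<lambda>x. (B x f, B x e, p x)) ` U \<subseteq> UNIV \<times> UNIV \<times> U1"
      using p by auto
  qed
  then have "card U = card ((UNIV :: bit set) \<times> (UNIV :: bit set) \<times> U1)"
    using bij_betw_same_card by metis
  also have "\<dots> = CARD(bit) * CARD(bit) * card U1"
    by (simp add: card_cartesian_product)
  also have "(UNIV :: bit set) = {0, 1}"
    using bit_not_zero_iff by blast
  then have "CARD(bit) = 2"
    by (metis card_2_iff zero_neq_one)
  finally show "card U = 4 * card U1"
    by simp
qed

lemma nondeg_hyperbolic_pair:
  assumes U: "nondeg U" and "card U > 1"
  obtains e f where "e \<in> U" "f \<in> U" "B e f = 1"
proof -
  have "U \<noteq> {0}"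
    using assms by auto
  then obtain e where "e \<in> U" "e \<noteq> 0"
    using nondeg_0[OF U] by blast
  then show ?thesis
    using that nondegD[OF U] by (metis bit_not_zero_iff)
qed

text \<open>Induction on the size: split a hyperbolic pair off each space, match the pairs, and
  apply the hypothesis to the complements, which are four times smaller.\<close>

lemma isometry_exists:
  assumes "nondeg U" and "nondeg U'" and "card U = card U'"
  shows "\<exists>h. (\<forall>x\<in>U. h x \<in> U') \<and> (\<forall>x\<in>U. \<forall>y\<in>U. h (x + y) = h x + h y \<and> B (h x) (h y) = B x y)"
  using assms
proof (induction "card U" arbitrary: U U' rule: less_induct)
  case less
  show ?case
  proof (cases "card U > 1")
    case False
    then have "U = {0}"
      using nondeg_0[OF less.prems(1)]
      by (metis One_nat_def card_1_singletonE card_gt_0_iff empty_iff finite le_antisym less_Suc_eq_le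
          not_less singletonD Suc_leI)
    then show ?thesis
      using nondeg_0[OF less.prems(2)] by (intro exI[of _ "\<lambda>_. 0"]) auto
  next
    case True
    obtain e f where ef: "e \<in> U" "f \<in> U" "B e f = 1"
      using nondeg_hyperbolic_pair[OF less.prems(1) True] by blast
    obtain e' f' where ef': "e' \<in> U'" "f' \<in> U'" "B e' f' = 1"
      using nondeg_hyperbolic_pair[OF less.prems(2)] True less.prems(3) by metis
    define p where "p x = x + B x f *s e + B x e *s f" for x
    define U1 where "U1 = {x \<in> U. B x e = 0 \<and> B x f = 0}"
    define U1' where "U1' = {x \<in> U'. B x e' = 0 \<and> B x f' = 0}"
    note P = hyperbolic_pair_complement[OF less.prems(1) ef, folded p_def U1_def]
    note P' = hyperbolic_pair_complement(1,2)[OF less.prems(2) ef', folded U1'_def]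
    have "\<exists>h. (\<forall>x\<in>U1. h x \<in> U1') \<and>
      (\<forall>x\<in>U1. \<forall>y\<in>U1. h (x + y) = h x + h y \<and> B (h x) (h y) = B x y)"
      using P(1,2) P' True less.prems(3) by (intro less.hyps) auto
    then obtain h where h: "\<And>x. x \<in> U1 \<Longrightarrow> h x \<in> U1'"
      "\<And>x y. x \<in> U1 \<Longrightarrow> y \<in> U1 \<Longrightarrow> h (x + y) = h x + h y"
      "\<And>x y. x \<in> U1 \<Longrightarrow> y \<in> U1 \<Longrightarrow> B (h x) (h y) = B x y"
      by blast
    \<comment> \<open>\<open>k\<close> sends \<open>e\<close> to \<open>e'\<close>, \<open>f\<close>
      to \<open>f'\<close>, and follows \<open>h\<close> on the complement
      \<open>U1\<close>.\<close>
    define k where "k x = B x f *s e' + B x e *s f' + h (p x)" for x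
    have sc: "c *s x \<in> U'" if "x \<in> U'" for c x
      using that nondeg_0[OF less.prems(2)] by (simp add: bit_vec_scale)
    show ?thesis
    proof (intro exI[of _ k] conjI ballI)
      fix x assume "x \<in> U"
      then show "k x \<in> U'"
        using h(1)[OF P(3), of x] ef'
        by (auto simp: k_def U1'_def intro!: nondeg_add[OF less.prems(2)] sc)
    next
      fix x y assume xy: "x \<in> U" "y \<in> U"
      show "k (x + y) = k x + k y"
        unfolding k_def P(4) h(2)[OF P(3)[OF xy(1)] P(3)[OF xy(2)]] form_add_left
          vec.scale_left_distrib
        by (simp add: add_ac)
      have "B (h (p x)) e' = 0" "B (h (p x)) f' = 0" "B (h (p y)) e' = 0" "B (h (p y)) f' = 0"
        using h(1)[OF P(3)[OF xy(1)]] h(1)[OF P(3)[OF xy(2)]] by (auto simp: U1'_def)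
      then have "B (k x) (k y) = B x f * B y e + B x e * B y f + B (h (p x)) (h (p y))"
        using ef'(3) form_sym[of f' e'] form_sym[of e' "h (p y)"] form_sym[of f' "h (p y)"]
        by (simp add: k_def form_add_left form_add_right form_scale_left form_scale_right)
      also have "\<dots> = B x y"
        using h(3)[OF P(3)[OF xy(1)] P(3)[OF xy(2)]] P(5)[of x y] by simp
      finally show "B (k x) (k y) = B x y" .
    qed
  qed
qed

text \<open>Witt's theorem for nondegenerate subspaces: glue an isometry from \<open>U\<close> to
  \<open>U'\<close> with one between the orthogonal complements, which also have equal size.\<close>

lemma Sp_transitive_nondeg:
  assumes U: "nondeg U" and U': "nondeg U'" and card: "card U = card U'"
  obtains g where "g \<in> Sp B" "g ` U = U'"
proof -
  have "card U > 0"
    using nondeg_0[OF U] by (metis card_gt_0_iff empty_iff finite)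
  then have card': "card (perp B U) = card (perp B U')"
    using card_nondeg_perp[OF U] card_nondeg_perp[OF U'] card by (metis mult_cancel1 less_numeral_extra(3))
  from isometry_exists[OF U U' card] obtain h
    where h: "\<And>x. x \<in> U \<Longrightarrow> h x \<in> U'" "\<And>x y. x \<in> U \<Longrightarrow> y \<in> U \<Longrightarrow> h (x + y) = h x + h y"
      "\<And>x y. x \<in> U \<Longrightarrow> y \<in> U \<Longrightarrow> B (h x) (h y) = B x y"
    by blast
  from isometry_exists[OF nondeg_perp[OF U] nondeg_perp[OF U'] card'] obtain k
    where k: "\<And>x. x \<in> perp B U \<Longrightarrow> k x \<in> perp B U'"
      "\<And>x y. x \<in> perp B U \<Longrightarrow> y \<in> perp B U \<Longrightarrow> k (x + y) = k x + k y"
      "\<And>x y. x \<in> perp B U \<Longrightarrow> y \<in> perp B U \<Longrightarrow> B (k x) (k y) = B x y"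
    by blast
  \<comment> \<open>\<open>u x\<close> is the component of \<open>x\<close> in \<open>U\<close>; in
    characteristic 2 the other component is \<open>x + u x\<close>.\<close>
  define u where "u x = (SOME u. u \<in> U \<and> x + u \<in> perp B U)" for x
  have ex: "u x \<in> U \<and> x + u x \<in> perp B U" for x
  proof -
    obtain a w where "a \<in> U" "w \<in> perp B U" "x = a + w"
      using nondeg_perp_decompose[OF U] by blast
    then have "a \<in> U \<and> x + a \<in> perp B U"
      by (simp add: add_ac)
    then show ?thesis
      unfolding u_def by (rule someI)
  qed
  \<comment> \<open>Two candidates differ by an element of \<open>U\<close> orthogonal to
    \<open>U\<close>; this uniqueness is what makes \<open>u\<close> additive.\<close>
  have uniq: "u x = a" if "a \<in> U" "x + a \<in> perp B U" for x a
  proof -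
    have "(x + u x) + (x + a) \<in> perp B U"
      using ex[of x] that subspace_perp[of U] by (simp only: subspace_bit_iff)
    then have "u x + a \<in> perp B U"
      by (simp add: add_ac)
    then have "u x + a = 0"
      using ex[of x] that by (intro nondegD[OF U] nondeg_add[OF U]) (auto simp: perp_def)
    then show ?thesis
      by (simp add: bit_vec_add_eq_0_iff)
  qed
  define g where "g x = h (u x) + k (x + u x)" for x
  have u_add: "u (x + y) = u x + u y" for x y
  proof (rule uniq)
    show "u x + u y \<in> U"
      using ex by (intro nondeg_add[OF U]) auto
    have "(x + u x) + (y + u y) \<in> perp B U"
      using ex subspace_perp[of U] by (simp only: subspace_bit_iff)
    then show "x + y + (u x + u y) \<in> perp B U"
      by (simp add: add_ac)
  qed
  have orth: "B a b = 0" "B b a = 0" if "a \<in> T" "b \<in> perp B T" for a b T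
    using that form_sym[of a b] by (auto simp: perp_def)
  have g: "g \<in> Sp B"
  proof (rule SpI)
    fix x y
    have "k (x + y + u (x + y)) = k ((x + u x) + (y + u y))"
      by (simp add: u_add add_ac)
    also have "\<dots> = k (x + u x) + k (y + u y)"
      using ex by (intro k(2)) auto
    finally show "g (x + y) = g x + g y"
      unfolding g_def using ex by (simp add: u_add h(2) add_ac)
    have "B (h (u x)) (k (y + u y)) = 0" "B (k (x + u x)) (h (u y)) = 0"
      using orth[OF h(1) k(1)] ex by simp_all
    then have "B (g x) (g y) = B (h (u x)) (h (u y)) + B (k (x + u x)) (k (y + u y))"
      by (simp add: g_def form_add_left form_add_right)
    also have "\<dots> = B (u x) (u y) + B (x + u x) (y + u y)"
      using ex by (simp add: h(3) k(3))
    also have "\<dots> = B (u x + (x + u x)) (u y + (y + u y))"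
    proof -
      have "B (u x) (y + u y) = 0" "B (x + u x) (u y) = 0"
        using orth[of "u _" U] ex by simp_all
      then show ?thesis
        by (simp only: form_add_left[of "u x" "x + u x"] form_add_right[of _ "u y" "y + u y"]
            add_0_left add_0_right)
    qed
    also have "\<dots> = B x y"
      by (simp add: add_ac)
    finally show "B (g x) (g y) = B x y" .
  qed
  have k0: "k 0 = 0"
    using k(2)[of 0 0] subspace_perp[of U] by (simp add: subspace_bit_iff)
  have "g x \<in> U'" if "x \<in> U" for x
  proof -
    have "u x = x"
      using that subspace_perp[of U] by (intro uniq) (auto simp: subspace_bit_iff)
    then show ?thesis
      using that h(1) k0 by (simp add: g_def)
  qed
  then have "g ` U \<subseteq> U'" by blast
  moreover have "card (g ` U) = card U'"
    using Sp_bij[OF g] card by (metis bij_is_inj card_image inj_on_subset subset_UNIV)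
  ultimately have "g ` U = U'"
    by (intro card_subset_eq) auto
  with g that show ?thesis by blast
qed

end

section \<open>Orthogonal decompositions\<close>

lemma prod_less_0_iff_odd_card:
  fixes f :: "'a \<Rightarrow> 'b :: linordered_idom"
  assumes "finite I" and "\<And>i. i \<in> I \<Longrightarrow> f i \<noteq> 0"
  shows "prod f I < 0 \<longleftrightarrow> odd (card {i \<in> I. f i < 0})"
  using assms
proof (induction I rule: finite_induct)
  case (insert a I)
  have "{i \<in> insert a I. f i < 0} = (if f a < 0 then insert a {i \<in> I. f i < 0} else {i \<in> I. f i < 0})"
    by auto
  moreover have "prod f I \<noteq> 0"
    using insert by auto
  ultimately show ?case
    using insert by (auto simp: mult_less_0_iff not_less_iff_gr_or_eq)
qed simp

context symplectic_space
begin

lemma quad_translate: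
  assumes "quad \<phi>"
  shows "quad (\<lambda>x. \<phi> x + B v x)"
  using assms by (auto simp: quad_iff form_add_right add_ac)

text \<open>Completing the square: \<open>\<phi> x + B v x = \<phi> v + \<phi> (v + x)\<close>. So
  the type on \<open>U\<close> flips exactly when \<open>\<phi> v = 1\<close>.\<close>

lemma gauss_sum_translate:
  assumes U: "nondeg U" and \<phi>: "quad \<phi>" and v: "v \<in> U"
  shows "gauss_sum (\<lambda>x. \<phi> x + B v x) U = bit_sgn (\<phi> v) * gauss_sum \<phi> U"
proof -
  have "\<phi> x + B v x = \<phi> v + \<phi> (v + x)" for x
    by (simp add: quad_add[OF \<phi>] add_ac)
  then have "gauss_sum (\<lambda>x. \<phi> x + B v x) U = bit_sgn (\<phi> v) * (\<Sum>x\<in>U. bit_sgn (\<phi> (v + x)))"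
    by (simp add: gauss_sum_def bit_sgn_add sum_distrib_left)
  also have "(\<Sum>x\<in>U. bit_sgn (\<phi> (v + x))) = gauss_sum \<phi> U"
    unfolding gauss_sum_def
    using sum_translate_subspace[OF nondeg_subspace[OF U] v, of "\<lambda>x. bit_sgn (\<phi> x)"] .
  finally show ?thesis .
qed

lemma gauss_sum_cong: "(\<And>x. x \<in> U \<Longrightarrow> \<phi> x = \<psi> x) \<Longrightarrow> gauss_sum \<phi> U = gauss_sum \<psi> U"
  by (simp add: gauss_sum_def)

lemma gauss_sum_nonzero:
  assumes "nondeg U" "quad \<phi>"
  shows "gauss_sum \<phi> U \<noteq> 0"
  using gauss_sum_square[OF assms] nondeg_0[OF assms(1)] by auto

text \<open>For a hyperbolic pair \<open>\<phi> e + \<phi> f + \<phi> (e + f) = 1\<close>, so one of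
  the three values is 1.\<close>

lemma nonsingular_vector:
  assumes U: "nondeg U" and "card U > 1" and \<phi>: "quad \<phi>"
  obtains v where "v \<in> U" "\<phi> v = 1"
proof -
  obtain e f where ef: "e \<in> U" "f \<in> U" "B e f = 1"
    using nondeg_hyperbolic_pair[OF assms(1,2)] .
  then have "\<phi> (e + f) + \<phi> e + \<phi> f = 1"
    by (simp add: quad_add[OF \<phi>] add_ac)
  then have "\<phi> e = 1 \<or> \<phi> f = 1 \<or> \<phi> (e + f) = 1"
    by (cases "\<phi> e"; cases "\<phi> f"; cases "\<phi> (e + f)") auto
  then show ?thesis
    using that ef nondeg_add[OF U] by blast
qed

end

locale decomposed_space = symplectic_space B
  for B :: "bit ^ 'm \<Rightarrow> bit ^ 'm \<Rightarrow> bit" +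
  fixes n t :: nat and V :: "nat \<Rightarrow> (bit ^ 'm) set"
  assumes n_pos: "0 < n" and decomp: "decomposition B n t V"
begin

definition idx :: "nat set" where "idx = {1..t}"

lemma finite_idx [simp]: "finite idx"
  by (simp add: idx_def)

lemma t_ge_2: "2 \<le> t"
  using decomp by (simp add: decomposition_def idx_def)

lemma nondeg_V: "i \<in> idx \<Longrightarrow> nondeg (V i)"
  using decomp by (simp add: decomposition_def idx_def)

lemma dim_V: "i \<in> idx \<Longrightarrow> vec.dim (V i) = 2 * n div t"
  using decomp by (simp add: decomposition_def idx_def)

lemma card_V: "i \<in> idx \<Longrightarrow> card (V i) > 1"
proof -
  assume i: "i \<in> idx"
  have "t dvd n"
    using decomp by (simp add: decomposition_def idx_def)
  then have "2 * n div t > 0"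
    using n_pos t_ge_2 by (auto elim!: dvdE)
  then show ?thesis
    by (simp add: card_subspace_bit[OF nondeg_subspace[OF nondeg_V[OF i]]] dim_V[OF i] one_less_power
        del: One_nat_def)
qed

lemma orth_V: "i \<in> idx \<Longrightarrow> j \<in> idx \<Longrightarrow> i \<noteq> j \<Longrightarrow> x \<in> V i \<Longrightarrow> y \<in> V j \<Longrightarrow> B x y = 0"
  using decomp by (simp add: decomposition_def idx_def)

text \<open>Directness of the sum, phrased as a reindexing of the space by tuples for use in
  \<open>gauss_sum_UNIV\<close>.\<close>

lemma bij_betw_components: "bij_betw (\<lambda>f. \<Sum>i\<in>idx. f i) (\<Pi>\<^sub>E i\<in>idx. V i) UNIV"
proof -
  have ex1: "\<exists>!f. f \<in> (\<Pi>\<^sub>E i\<in>idx. V i) \<and> v = (\<Sum>i\<in>idx. f i)" for v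
    using decomp unfolding decomposition_def idx_def by blast
  show ?thesis
    unfolding bij_betw_def
  proof
    show "inj_on (\<lambda>f. \<Sum>i\<in>idx. f i) (\<Pi>\<^sub>E i\<in>idx. V i)"
      using ex1 by (intro inj_onI) blast
    show "(\<lambda>f. \<Sum>i\<in>idx. f i) ` (\<Pi>\<^sub>E i\<in>idx. V i) = UNIV"
      using ex1 by blast
  qed
qed

lemma components:
  obtains f where "\<And>i. i \<in> idx \<Longrightarrow> f i \<in> V i" "x = (\<Sum>i\<in>idx. f i)"
proof -
  have "x \<in> (\<lambda>f. \<Sum>i\<in>idx. f i) ` (\<Pi>\<^sub>E i\<in>idx. V i)"
    using bij_betw_components by (simp add: bij_betw_def)
  then show ?thesis
    using that by blast
qed

lemma form_sum_V:
  assumes "J \<subseteq> idx" and "\<And>j. j \<in> J \<Longrightarrow> f j \<in> V j" and "i \<in> idx" and "x \<in> V i"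
  shows "B (\<Sum>j\<in>J. f j) x = (if i \<in> J then B (f i) x else 0)"
proof -
  have "B (\<Sum>j\<in>J. f j) x = (\<Sum>j\<in>J. if j = i then B (f i) x else 0)"
    unfolding form_sum_left using assms orth_V by (intro sum.cong) auto
  also have "\<dots> = (if i \<in> J then B (f i) x else 0)"
    using assms(1) finite_subset[of J idx] by simp
  finally show ?thesis .
qed

lemma quad_sum_V:
  assumes \<phi>: "quad \<phi>" and f: "\<And>i. i \<in> idx \<Longrightarrow> f i \<in> V i"
  shows "\<phi> (\<Sum>i\<in>idx. f i) = (\<Sum>i\<in>idx. \<phi> (f i))"
proof -
  have "\<phi> (\<Sum>i\<in>J. f i) = (\<Sum>i\<in>J. \<phi> (f i))" if "finite J" "J \<subseteq> idx" for J
    using that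
  proof (induction J rule: finite_induct)
    case (insert j J)
    then have "B (\<Sum>i\<in>J. f i) (f j) = 0"
      using f by (subst form_sum_V[of J f j]) auto
    then show ?case
      using insert by (simp add: quad_add[OF \<phi>] form_sym[of "f j"])
  qed (simp add: quad_0[OF \<phi>])
  then show ?thesis by simp
qed

lemma quad_eqI_V:
  assumes "quad \<phi>" "quad \<psi>" and eq: "\<And>i x. i \<in> idx \<Longrightarrow> x \<in> V i \<Longrightarrow> \<phi> x = \<psi> x"
  shows "\<phi> = \<psi>"
proof
  fix x
  obtain f where f: "\<And>i. i \<in> idx \<Longrightarrow> f i \<in> V i" "x = (\<Sum>i\<in>idx. f i)"
    using components by blast
  show "\<phi> x = \<psi> x"
    unfolding f(2) using f(1) eq assms(1,2) by (simp add: quad_sum_V)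
qed

text \<open>\<open>\<phi>\<close> is additive over orthogonal components, so the signs multiply and
  the sum over tuples factorises.\<close>

lemma gauss_sum_UNIV:
  assumes \<phi>: "quad \<phi>"
  shows "gauss_sum \<phi> UNIV = (\<Prod>i\<in>idx. gauss_sum \<phi> (V i))"
proof -
  have "gauss_sum \<phi> UNIV = (\<Sum>f\<in>(\<Pi>\<^sub>E i\<in>idx. V i). bit_sgn (\<phi> (\<Sum>i\<in>idx. f i)))"
    unfolding gauss_sum_def by (rule sum.reindex_bij_betw[OF bij_betw_components, symmetric])
  also have "\<dots> = (\<Sum>f\<in>(\<Pi>\<^sub>E i\<in>idx. V i). \<Prod>i\<in>idx. bit_sgn (\<phi> (f i)))"
    by (intro sum.cong refl) (auto simp: quad_sum_V[OF \<phi>] bit_sgn_sum PiE_def Pi_def)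
  also have "\<dots> = (\<Prod>i\<in>idx. gauss_sum \<phi> (V i))"
    unfolding gauss_sum_def by (rule prod_sum_PiE[symmetric]) auto
  finally show ?thesis .
qed

section \<open>The pattern of types on the summands\<close>

text \<open>The set \<open>M(\<phi>)\<close> of the introduction, called the pattern of
  \<open>\<phi>\<close> below; \<open>O_set\<close> prescribes its size.\<close>

definition minus_set :: "(bit ^ 'm \<Rightarrow> bit) \<Rightarrow> nat set" where
  "minus_set \<phi> = {i \<in> idx. has_type_on \<phi> (V i) Minus}"

lemma minus_set_subset: "minus_set \<phi> \<subseteq> idx"
  by (auto simp: minus_set_def)

lemma finite_minus_set: "finite (minus_set \<phi>)"
  using minus_set_subset by (rule finite_subset) simp

lemma minus_set_gauss_sum: "quad \<phi> \<Longrightarrow> minus_set \<phi> = {i \<in> idx. gauss_sum \<phi> (V i) < 0}"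
  unfolding minus_set_def using nondeg_V has_type_on_Minus_iff_gauss_sum by blast

text \<open>The Gauss sum of the whole space is a product of nonzero ones, so its sign is the parity
  of the number of negative factors.\<close>

lemma Q_iff: "\<phi> \<in> Q B \<epsilon> \<longleftrightarrow> quad \<phi> \<and> (odd (card (minus_set \<phi>)) \<longleftrightarrow> \<epsilon> = Minus)"
proof (cases "quad \<phi>")
  case True
  have "odd (card (minus_set \<phi>)) \<longleftrightarrow> gauss_sum \<phi> UNIV < 0"
    unfolding gauss_sum_UNIV[OF True] minus_set_gauss_sum[OF True]
    by (rule prod_less_0_iff_odd_card[symmetric]) (use nondeg_V gauss_sum_nonzero True in auto)
  then have "odd (card (minus_set \<phi>)) \<longleftrightarrow> has_type_on \<phi> UNIV Minus"
    using has_type_on_Minus_iff_gauss_sum[OF nondeg_UNIV True] by blast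
  then show ?thesis
    using True has_type_on_Plus_iff[OF nondeg_UNIV True]
    by (cases \<epsilon>) (auto simp: Q_def simp del: has_type_on.simps)
qed (simp add: Q_def)

text \<open>On \<open>V i\<close> the sum acts only through \<open>w i\<close>, so
  \<open>gauss_sum_translate\<close> decides whether the type there flips.\<close>

lemma minus_set_translate:
  assumes \<phi>: "quad \<phi>" and J: "J \<subseteq> idx" and w: "\<And>j. j \<in> J \<Longrightarrow> w j \<in> V j"
  shows "minus_set (\<lambda>x. \<phi> x + B (\<Sum>j\<in>J. w j) x)
    = {i \<in> idx. i \<in> minus_set \<phi> \<longleftrightarrow> \<not> (i \<in> J \<and> \<phi> (w i) = 1)}"
proof -
  let ?\<psi> = "\<lambda>x. \<phi> x + B (\<Sum>j\<in>J. w j) x"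
  have "i \<in> minus_set ?\<psi> \<longleftrightarrow> (i \<in> minus_set \<phi> \<longleftrightarrow> \<not> (i \<in> J \<and> \<phi> (w i) = 1))"
    if i: "i \<in> idx" for i
  proof -
    \<comment> \<open>For \<open>i\<close> outside \<open>J\<close> the translating vector is 0,
      where \<open>\<phi>\<close> vanishes.\<close>
    have g: "gauss_sum ?\<psi> (V i) = gauss_sum (\<lambda>x. \<phi> x + B (if i \<in> J then w i else 0) x) (V i)"
      using form_sum_V[OF J w i] by (intro gauss_sum_cong) auto
    also have "\<dots> = bit_sgn (\<phi> (if i \<in> J then w i else 0)) * gauss_sum \<phi> (V i)"
      using i w nondeg_0[OF nondeg_V[OF i]] by (intro gauss_sum_translate nondeg_V \<phi>) auto
    finally have "gauss_sum ?\<psi> (V i) =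
      (if i \<in> J \<and> \<phi> (w i) = 1 then - gauss_sum \<phi> (V i) else gauss_sum \<phi> (V i))"
      by (auto simp: quad_0[OF \<phi>] bit_sgn_def)
    then show ?thesis
      using gauss_sum_nonzero[OF nondeg_V[OF i] \<phi>] i
      unfolding minus_set_gauss_sum[OF \<phi>] minus_set_gauss_sum[OF quad_translate[OF \<phi>]] by auto
  qed
  then show ?thesis
    using minus_set_subset by blast
qed

text \<open>Translate by one nonsingular vector in each summand where the type has to change; by
  orthogonality the form is untouched on the other summands.\<close>

lemma Q_with_minus_set:
  assumes \<phi>: "\<phi> \<in> Q B \<epsilon>" and A: "A \<subseteq> idx" "even (card A) \<longleftrightarrow> even (card (minus_set \<phi>))"
  obtains \<psi> where "\<psi> \<in> Q B \<epsilon>" "minus_set \<psi> = A"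
    "\<And>i x. \<lbrakk>i \<in> idx; i \<in> A \<longleftrightarrow> i \<in> minus_set \<phi>; x \<in> V i\<rbrakk> \<Longrightarrow> \<psi> x = \<phi> x"
proof -
  have q: "quad \<phi>"
    using \<phi> by (rule quad_if_Q)
  \<comment> \<open>The symmetric difference of \<open>A\<close> and
    \<open>minus_set \<phi>\<close>.\<close>
  define J where "J = {i \<in> idx. i \<in> A \<longleftrightarrow> i \<notin> minus_set \<phi>}"
  have "\<exists>v. v \<in> V j \<and> \<phi> v = 1" if "j \<in> idx" for j
    using nonsingular_vector[OF nondeg_V[OF that] card_V[OF that] q] by blast
  then obtain w where w: "\<And>j. j \<in> idx \<Longrightarrow> w j \<in> V j" "\<And>j. j \<in> idx \<Longrightarrow> \<phi> (w j) = 1"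
    by metis
  define \<psi> where "\<psi> x = \<phi> x + B (\<Sum>j\<in>J. w j) x" for x
  have J: "J \<subseteq> idx"
    by (auto simp: J_def)
  have M: "minus_set \<psi> = A"
  proof -
    have "minus_set \<psi> = {i \<in> idx. i \<in> minus_set \<phi> \<longleftrightarrow> \<not> (i \<in> J \<and> \<phi> (w i) = 1)}"
      unfolding \<psi>_def using w(1) J by (intro minus_set_translate q) auto
    also have "\<dots> = A"
      using w(2) A(1) by (auto simp: J_def)
    finally show ?thesis .
  qed
  have "quad \<psi>"
    unfolding \<psi>_def by (rule quad_translate[OF q])
  then have "\<psi> \<in> Q B \<epsilon>"
    using \<phi> A(2) M unfolding Q_iff by simp
  moreover have "\<psi> x = \<phi> x" if "i \<in> idx" "i \<in> A \<longleftrightarrow> i \<in> minus_set \<phi>" "x \<in> V i" for i x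
    using that form_sum_V[of J w i x] w(1) J by (auto simp: \<psi>_def J_def)
  ultimately show ?thesis
    using that M by blast
qed

text \<open>Supplies, for \<open>v \<noteq> 0\<close>, a form with the same pattern but another
  restriction to \<open>V i\<close>.\<close>

lemma Q_translate_singular:
  assumes \<phi>: "\<phi> \<in> Q B \<epsilon>" and i: "i \<in> idx" and v: "v \<in> V i" "\<phi> v = 0"
  shows "(\<lambda>x. \<phi> x + B v x) \<in> Q B \<epsilon>" and "minus_set (\<lambda>x. \<phi> x + B v x) = minus_set \<phi>"
proof -
  have q: "quad \<phi>"
    using \<phi> by (rule quad_if_Q)
  show *: "minus_set (\<lambda>x. \<phi> x + B v x) = minus_set \<phi>"
    using minus_set_translate[OF q, of "{i}" "\<lambda>_. v"] i v minus_set_subset[of \<phi>] by auto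
  then show "(\<lambda>x. \<phi> x + B v x) \<in> Q B \<epsilon>"
    using \<phi> quad_translate[OF q] unfolding Q_iff by simp
qed

section \<open>The decomposition stabiliser as permutations of indices\<close>

text \<open>A hyperbolic pair in a repeated summand would be orthogonal. Distinctness lets
  permutations of summands be read as permutations of indices.\<close>

lemma inj_on_V: "inj_on V idx"
proof (rule inj_onI, rule ccontr)
  fix i j assume ij: "i \<in> idx" "j \<in> idx" "V i = V j" "i \<noteq> j"
  obtain e f where "e \<in> V i" "f \<in> V i" "B e f = 1"
    using nondeg_hyperbolic_pair[OF nondeg_V card_V] ij(1) by blast
  then show False
    using orth_V[of i j e f] ij by auto
qed

text \<open>\<open>\<sigma>\<close> is injective because \<open>g\<close> and \<open>V\<close> are,
  and types travel with the summands by \<open>has_type_on_form_act\<close>.\<close>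

lemma decomp_stab_permutes:
  assumes "g \<in> Sp_decomp_stab B t V"
  obtains \<sigma> where "bij_betw \<sigma> idx idx" "\<And>i. i \<in> idx \<Longrightarrow> g ` V i = V (\<sigma> i)"
    "\<And>\<phi>. quad \<phi> \<Longrightarrow> minus_set (form_act g \<phi>) = \<sigma> ` minus_set \<phi>"
proof -
  have g: "g \<in> Sp B" and img: "(\<lambda>U. g ` U) ` (V ` idx) = V ` idx"
    using assms by (simp_all add: Sp_decomp_stab_def idx_def)
  have "\<forall>i\<in>idx. \<exists>j. j \<in> idx \<and> g ` V i = V j"
    using img by blast
  then obtain \<sigma> where \<sigma>: "\<And>i. i \<in> idx \<Longrightarrow> \<sigma> i \<in> idx" "\<And>i. i \<in> idx \<Longrightarrow> g ` V i = V (\<sigma> i)"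
    by metis
  have "inj_on \<sigma> idx"
  proof (rule inj_onI)
    fix i j assume ij: "i \<in> idx" "j \<in> idx" "\<sigma> i = \<sigma> j"
    then have "g ` V i = g ` V j"
      using \<sigma>(2) by metis
    then have "V i = V j"
      using Sp_bij[OF g] by (simp add: bij_is_inj inj_image_eq_iff)
    then show "i = j"
      using inj_on_V ij by (simp add: inj_on_eq_iff)
  qed
  then have bij: "bij_betw \<sigma> idx idx"
    using \<sigma>(1) endo_inj_surj[of idx \<sigma>] by (simp add: bij_betw_def image_subset_iff)
  have "minus_set (form_act g \<phi>) = \<sigma> ` minus_set \<phi>" if \<phi>: "quad \<phi>" for \<phi>
  proof -
    have "\<sigma> i \<in> minus_set (form_act g \<phi>) \<longleftrightarrow> i \<in> minus_set \<phi>" if "i \<in> idx" for i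
      using has_type_on_form_act[OF g \<phi> nondeg_V[OF that], of Minus] that \<sigma>
      by (simp add: minus_set_def del: has_type_on.simps)
    moreover have "minus_set (form_act g \<phi>) \<subseteq> \<sigma> ` idx"
      using minus_set_subset bij by (simp add: bij_betw_def)
    ultimately show ?thesis
      using minus_set_subset by blast
  qed
  then show ?thesis
    using that bij \<sigma>(2) by blast
qed

lemma card_minus_set_form_act:
  assumes "g \<in> Sp_decomp_stab B t V" and "quad \<phi>"
  shows "card (minus_set (form_act g \<phi>)) = card (minus_set \<phi>)"
proof -
  obtain \<sigma> where \<sigma>: "bij_betw \<sigma> idx idx" "minus_set (form_act g \<phi>) = \<sigma> ` minus_set \<phi>"
    using decomp_stab_permutes[OF assms(1)] assms(2) by metis
  then show ?thesis
    using minus_set_subset by (metis bij_betw_def card_image inj_on_subset)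
qed

end

section \<open>Two orbits on quadratic forms\<close>

text \<open>Strong incidence-transitivity at a single codeword; the code itself returns at the end
  as the \<open>Sp\<close>-orbit of \<open>\<Delta>\<close>.\<close>

locale two_orbit_decomposition = decomposed_space B n t V
  for B :: "bit ^ 'm \<Rightarrow> bit ^ 'm \<Rightarrow> bit" and n t V +
  fixes \<epsilon> :: sign and \<Delta> :: "(bit ^ 'm \<Rightarrow> bit) set"
  assumes \<Delta>_subset: "\<Delta> \<subseteq> Q B \<epsilon>"
    and card_\<Delta>: "1 < card \<Delta>" "card \<Delta> < card (Q B \<epsilon>) - 1"
    and pair_transitive: "\<And>\<phi> \<psi> \<phi>' \<psi>'. \<lbrakk>\<phi> \<in> \<Delta>; \<psi> \<in> Q B \<epsilon> - \<Delta>; \<phi>' \<in> \<Delta>; \<psi>' \<in> Q B \<epsilon> - \<Delta>\<rbrakk> \<Longrightarrow>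
      \<exists>g\<in>Sp_set_stab B \<Delta>. form_act g \<phi> = \<phi>' \<and> form_act g \<psi> = \<psi>'"
    and irreducible: "irreducible_on_space (Sp_set_stab B \<Delta>)"
    and stab_subset: "Sp_set_stab B \<Delta> \<subseteq> Sp_decomp_stab B t V"
begin

text \<open>The transitivity is symmetric in \<open>\<Delta>\<close> and its complement, so later
  arguments need not know on which side a form lies.\<close>

lemma pair_transitive_sym:
  assumes "\<phi> \<in> Q B \<epsilon>" "\<phi>' \<in> Q B \<epsilon>" "\<psi> \<in> Q B \<epsilon>" "\<psi>' \<in> Q B \<epsilon>"
    and "\<phi> \<in> \<Delta> \<longleftrightarrow> \<phi>' \<in> \<Delta>" "\<psi> \<in> \<Delta> \<longleftrightarrow> \<psi>' \<in> \<Delta>" "\<phi> \<in> \<Delta> \<longleftrightarrow> \<psi> \<notin> \<Delta>"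
  obtains g where "g \<in> Sp_set_stab B \<Delta>" "form_act g \<phi> = \<phi>'" "form_act g \<psi> = \<psi>'"
proof (cases "\<phi> \<in> \<Delta>")
  case True
  then show ?thesis
    using pair_transitive[of \<phi> \<psi> \<phi>' \<psi>'] assms that by blast
next
  case False
  then show ?thesis
    using pair_transitive[of \<psi> \<phi> \<psi>' \<phi>'] assms that by blast
qed

text \<open>The two cardinality bounds leave at least two forms on each side.\<close>

lemma same_side_other:
  assumes "\<phi> \<in> Q B \<epsilon>"
  obtains \<phi>' where "\<phi>' \<in> Q B \<epsilon>" "\<phi>' \<noteq> \<phi>" "\<phi>' \<in> \<Delta> \<longleftrightarrow> \<phi> \<in> \<Delta>"
proof -
  have "card (Q B \<epsilon> - \<Delta>) = card (Q B \<epsilon>) - card \<Delta>"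
    using \<Delta>_subset by (intro card_Diff_subset) auto
  then have "1 < card (Q B \<epsilon> - \<Delta>)"
    using card_\<Delta> by linarith
  then have "\<exists>\<phi>'\<in>S. \<phi>' \<noteq> \<phi>" if "S = \<Delta> \<or> S = Q B \<epsilon> - \<Delta>" for S
    using that card_\<Delta>(1) card_mono[of "{\<phi>}" S] by fastforce
  then show ?thesis
    using that assms \<Delta>_subset by (metis Diff_iff subsetD)
qed

lemma opposite_side:
  obtains \<psi> where "\<psi> \<in> Q B \<epsilon>" "\<psi> \<in> \<Delta> \<longleftrightarrow> \<phi> \<notin> \<Delta>"
proof -
  have "\<Delta> \<noteq> {}" "\<Delta> \<noteq> Q B \<epsilon>"
    using card_\<Delta> by auto
  then show ?thesis
    using that \<Delta>_subset by blast
qed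

text \<open>Pairing both forms with one form on the opposite side yields a stabiliser element from
  \<open>\<phi>\<close> to \<open>\<phi>'\<close>, and it permutes the summands.\<close>

lemma card_minus_set_eq:
  assumes "\<phi> \<in> Q B \<epsilon>" "\<phi>' \<in> Q B \<epsilon>" "\<phi> \<in> \<Delta> \<longleftrightarrow> \<phi>' \<in> \<Delta>"
  shows "card (minus_set \<phi>) = card (minus_set \<phi>')"
proof -
  obtain \<psi> where "\<psi> \<in> Q B \<epsilon>" "\<psi> \<in> \<Delta> \<longleftrightarrow> \<phi> \<notin> \<Delta>"
    using opposite_side by blast
  then obtain g where "g \<in> Sp_set_stab B \<Delta>" "form_act g \<phi> = \<phi>'"
    using pair_transitive_sym[of \<phi> \<phi>' \<psi> \<psi>] assms by blast
  then show ?thesis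
    using card_minus_set_form_act[of g \<phi>] stab_subset quad_if_Q[OF assms(1)] by auto
qed

text \<open>The source of the contradictions below: \<open>\<sigma>\<close> fixes one pattern while
  moving the other, so the relative position of two patterns is an invariant.\<close>

lemma stabiliser_permutation:
  assumes "\<phi> \<in> Q B \<epsilon>" "\<psi> \<in> Q B \<epsilon>" "\<psi>' \<in> Q B \<epsilon>"
    and "\<phi> \<in> \<Delta> \<longleftrightarrow> \<psi> \<notin> \<Delta>" "\<psi> \<in> \<Delta> \<longleftrightarrow> \<psi>' \<in> \<Delta>"
  obtains g \<sigma> where "g \<in> Sp B" "form_act g \<phi> = \<phi>" "form_act g \<psi> = \<psi>'"
    "bij_betw \<sigma> idx idx" "\<And>i. i \<in> idx \<Longrightarrow> g ` V i = V (\<sigma> i)"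
    "\<sigma> ` minus_set \<phi> = minus_set \<phi>" "\<sigma> ` minus_set \<psi> = minus_set \<psi>'"
proof -
  obtain g where g: "g \<in> Sp_set_stab B \<Delta>" "form_act g \<phi> = \<phi>" "form_act g \<psi> = \<psi>'"
    using pair_transitive_sym[of \<phi> \<phi> \<psi> \<psi>'] assms by blast
  then have "g \<in> Sp B" "g \<in> Sp_decomp_stab B t V"
    using stab_subset by (auto simp: Sp_set_stab_def)
  moreover from this(2) obtain \<sigma> where "bij_betw \<sigma> idx idx" "\<And>i. i \<in> idx \<Longrightarrow> g ` V i = V (\<sigma> i)"
    "\<And>\<phi>. quad \<phi> \<Longrightarrow> minus_set (form_act g \<phi>) = \<sigma> ` minus_set \<phi>"
    using decomp_stab_permutes[of g] by blast
  ultimately show ?thesis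
    using that g(2,3) assms(1,2)[THEN quad_if_Q] by metis
qed

section \<open>Bounding the number of summands\<close>

text \<open>The smallest size of a pattern that the sign \<open>\<epsilon>\<close> allows.\<close>

definition parity :: nat where "parity = (if \<epsilon> = Minus then 1 else 0)"

lemma even_card_minus_set: "\<phi> \<in> Q B \<epsilon> \<Longrightarrow> even (card (minus_set \<phi>)) \<longleftrightarrow> even parity"
  by (auto simp: Q_iff parity_def)

lemma form_with_minus_set:
  assumes "A \<subseteq> idx" "even (card A) \<longleftrightarrow> even parity"
  obtains \<phi> where "\<phi> \<in> Q B \<epsilon>" "minus_set \<phi> = A"
proof -
  obtain \<phi>0 where "\<phi>0 \<in> Q B \<epsilon>"
    using opposite_side by blast
  then show ?thesis
    using Q_with_minus_set[of \<phi>0 \<epsilon> A] assms that even_card_minus_set by metis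
qed

text \<open>Otherwise the sizes \<open>parity\<close>, \<open>parity + 2\<close> and
  \<open>parity + 4\<close> all occur, but there are only two sides and the size is constant on
  each.\<close>

lemma t_less: "t < parity + 4"
proof (rule ccontr)
  assume "\<not> t < parity + 4"
  then have sub: "{1..parity + k} \<subseteq> idx" if "k \<le> 4" for k
    using that by (auto simp: idx_def)
  have *: "\<exists>\<phi>. \<phi> \<in> Q B \<epsilon> \<and> minus_set \<phi> = {1..parity + k}" if "k \<le> 4" "even k" for k
    using form_with_minus_set[OF sub[OF that(1)]] that(2) by auto
  obtain \<phi>0 \<phi>2 \<phi>4 where "\<phi>0 \<in> Q B \<epsilon>" "\<phi>2 \<in> Q B \<epsilon>" "\<phi>4 \<in> Q B \<epsilon>"
    and "minus_set \<phi>0 = {1..parity + 0}" "minus_set \<phi>2 = {1..parity + 2}" "minus_set \<phi>4 = {1..parity + 4}"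
    using *[of 0] *[of 2] *[of 4] by auto
  then show False
    using card_minus_set_eq[of \<phi>0 \<phi>2] card_minus_set_eq[of \<phi>0 \<phi>4] card_minus_set_eq[of \<phi>2 \<phi>4]
    by auto
qed

lemma t_not_4: "t \<noteq> 4"
proof
  assume t: "t = 4"
  \<comment> \<open>For \<open>parity = 0\<close> the bound \<open>t_less\<close> already gives
    \<open>t < 4\<close>.\<close>
  then have p: "parity = 1"
    using t_less by (auto simp: parity_def split: if_splits)
  have idx: "idx = {1, 2, 3, 4}"
    unfolding idx_def unfolding t by auto
  obtain \<phi> where \<phi>: "\<phi> \<in> Q B \<epsilon>" "minus_set \<phi> = {1}"
    using form_with_minus_set[of "{1}"] by (auto simp: idx p)
  obtain \<psi> where \<psi>: "\<psi> \<in> Q B \<epsilon>" "minus_set \<psi> = {1, 2, 3}"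
    using form_with_minus_set[of "{1, 2, 3}"] by (auto simp: idx p)
  obtain \<psi>' where \<psi>': "\<psi>' \<in> Q B \<epsilon>" "minus_set \<psi>' = {2, 3, 4}"
    using form_with_minus_set[of "{2, 3, 4}"] by (auto simp: idx p)
  have "\<phi> \<in> \<Delta> \<longleftrightarrow> \<psi> \<notin> \<Delta>" "\<phi> \<in> \<Delta> \<longleftrightarrow> \<psi>' \<notin> \<Delta>"
    using card_minus_set_eq[OF \<phi>(1) \<psi>(1)] card_minus_set_eq[OF \<phi>(1) \<psi>'(1)] \<phi> \<psi> \<psi>' by auto
  then obtain \<sigma> where \<sigma>: "\<sigma> ` minus_set \<phi> = minus_set \<phi>" "\<sigma> ` minus_set \<psi> = minus_set \<psi>'"
    using stabiliser_permutation[OF \<phi>(1) \<psi>(1) \<psi>'(1)] by metis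
  \<comment> \<open>An element fixing \<open>\<phi>\<close> fixes the index 1, which lies in the
    pattern of \<open>\<psi>\<close> but not in that of \<open>\<psi>'\<close>.\<close>
  have "\<sigma> 1 \<in> \<sigma> ` minus_set \<psi>"
    unfolding \<psi>(2) by blast
  moreover have "\<sigma> 1 = 1"
    using \<sigma>(1) \<phi>(2) by simp
  ultimately show False
    using \<sigma>(2) \<psi>'(2) by simp
qed

text \<open>Suppose a form with the extreme pattern \<open>A\<close> has a nonzero singular vector
  \<open>v\<close> in \<open>V i\<close>. A form agreeing with it on exactly this summand and the
  translate of that form by \<open>v\<close> have equal patterns, but the translate agrees with it
  on no summand, against transitivity. So forms with pattern \<open>A\<close> are anisotropic on all
  summands, hence equal, contradicting \<open>same_side_other\<close>.\<close>

lemma t_not_3: "t \<noteq> 3"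
proof
  assume t: "t = 3"
  have card_idx: "card idx = 3"
    unfolding idx_def unfolding t by simp
  \<comment> \<open>The pattern that is determined by its size: empty for sign plus, full for sign
    minus.\<close>
  define A where "A = (if parity = 0 then {} else idx)"
  have A: "A = {} \<and> parity = 0 \<or> A = idx \<and> parity = 1"
    by (auto simp: A_def parity_def)
  then have A_sub: "A \<subseteq> idx" by blast
  have anisotropic: "v = 0"
    if \<phi>: "\<phi> \<in> Q B \<epsilon>" "minus_set \<phi> = A" and i: "i \<in> idx" and v: "v \<in> V i" "\<phi> v = 0" for \<phi> i v
  proof -
    \<comment> \<open>\<open>C\<close> differs from \<open>A\<close> at the two indices other than
      \<open>i\<close>, so the parity is kept.\<close>
    define C where "C = (if parity = 0 then idx - {i} else {i})"
    have C: "A = {} \<and> C = idx - {i} \<and> card C = 2 \<and> card A = 0 \<or> A = idx \<and> C = {i} \<and> card C = 1 \<and> card A = 3"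
      using A i card_idx by (auto simp: C_def)
    have "C \<subseteq> idx" "even (card C) \<longleftrightarrow> even (card (minus_set \<phi>))"
      using C i by (auto simp: \<phi>(2))
    then obtain \<psi> where \<psi>: "\<psi> \<in> Q B \<epsilon>" "minus_set \<psi> = C"
      and \<psi>_eq: "\<And>j x. \<lbrakk>j \<in> idx; j \<in> C \<longleftrightarrow> j \<in> minus_set \<phi>; x \<in> V j\<rbrakk> \<Longrightarrow> \<psi> x = \<phi> x"
      using Q_with_minus_set[OF \<phi>(1), of C] by blast
    have \<psi>_i: "\<psi> x = \<phi> x" if "x \<in> V i" for x
      using C i that by (intro \<psi>_eq[of i]) (auto simp: \<phi>(2))
    define \<psi>' where "\<psi>' x = \<psi> x + B v x" for x
    \<comment> \<open>\<open>v\<close> is singular for \<open>\<psi>\<close> too, since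
      \<open>\<psi>\<close> and \<open>\<phi>\<close> agree on \<open>V i\<close>.\<close>
    have \<psi>': "\<psi>' \<in> Q B \<epsilon>" "minus_set \<psi>' = C"
      unfolding \<psi>'_def using Q_translate_singular[OF \<psi>(1) i v(1)] \<psi>(2) \<psi>_i[OF v(1)] v(2) by auto
    have "\<phi> \<in> \<Delta> \<longleftrightarrow> \<psi> \<notin> \<Delta>" "\<phi> \<in> \<Delta> \<longleftrightarrow> \<psi>' \<notin> \<Delta>"
      using card_minus_set_eq[OF \<phi>(1) \<psi>(1)] card_minus_set_eq[OF \<phi>(1) \<psi>'(1)] C
      unfolding \<phi>(2) \<psi>(2) \<psi>'(2) by fastforce+
    then obtain g \<sigma> where g: "g \<in> Sp B" "form_act g \<phi> = \<phi>" "form_act g \<psi> = \<psi>'"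
      and \<sigma>: "bij_betw \<sigma> idx idx" "g ` V i = V (\<sigma> i)" "\<sigma> ` C = C"
      using stabiliser_permutation[OF \<phi>(1) \<psi>(1) \<psi>'(1)] i \<psi>(2) \<psi>'(2) by metis
    \<comment> \<open>Either \<open>C\<close> or its complement is \<open>{i}\<close>, and
      \<open>\<sigma>\<close> preserves both.\<close>
    have "\<sigma> i = i"
    proof -
      have "\<sigma> ` (idx - C) = idx - C"
        using \<sigma>(1,3) C i by (subst inj_on_image_set_diff[of _ idx]) (auto simp: bij_betw_def)
      then have "\<sigma> ` {i} = {i}"
        using C \<sigma>(3) i by (auto simp: double_diff)
      then show ?thesis by simp
    qed
    \<comment> \<open>With \<open>y = g x\<close>:
      \<open>\<psi>' y = \<psi> x = \<phi> x = \<phi> y = \<psi> y\<close>.\<close>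
    have "B v y = 0" if "y \<in> V i" for y
    proof -
      have "y \<in> g ` V i"
        using \<sigma>(2) \<open>\<sigma> i = i\<close> that by simp
      then obtain x where x: "x \<in> V i" "y = g x"
        by blast
      have "\<psi>' y = \<psi> x" "\<phi> y = \<phi> x"
        using form_act_apply[OF g(1), of _ x] g(2,3) x(2) by metis+
      then have "\<psi>' y = \<psi> y"
        using \<psi>_i x(1) that by simp
      then show ?thesis
        by (simp add: \<psi>'_def)
    qed
    then show "v = 0"
      using nondegD[OF nondeg_V[OF i] v(1)] by blast
  qed
  obtain \<phi> where \<phi>: "\<phi> \<in> Q B \<epsilon>" "minus_set \<phi> = A"
  proof -
    have "even (card A) \<longleftrightarrow> even parity"
      using A card_idx by auto
    then show ?thesis
      using form_with_minus_set[OF A_sub] that by blast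
  qed
  obtain \<phi>' where \<phi>': "\<phi>' \<in> Q B \<epsilon>" "\<phi>' \<noteq> \<phi>" "\<phi>' \<in> \<Delta> \<longleftrightarrow> \<phi> \<in> \<Delta>"
    using same_side_other[OF \<phi>(1)] by blast
  have "card (minus_set \<phi>') = card A"
    using card_minus_set_eq[OF \<phi>'(1) \<phi>(1)] \<phi> \<phi>'(3) by simp
  then have M': "minus_set \<phi>' = A"
    using A minus_set_subset[of \<phi>'] finite_minus_set[of \<phi>'] card_subset_eq[of idx "minus_set \<phi>'"]
    by auto
  \<comment> \<open>Both forms take the value 1 at every nonzero vector of each summand.\<close>
  have "\<phi>' = \<phi>"
  proof (rule quad_eqI_V)
    fix i x assume ix: "i \<in> idx" "x \<in> V i"
    show "\<phi>' x = \<phi> x"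
    proof (cases "x = 0")
      case True
      then show ?thesis
        using quad_0[OF quad_if_Q[OF \<phi>(1)]] quad_0[OF quad_if_Q[OF \<phi>'(1)]] by simp
    next
      case False
      then have "\<phi> x \<noteq> 0" "\<phi>' x \<noteq> 0"
        using anisotropic[OF \<phi> ix] anisotropic[OF \<phi>'(1) M' ix] by blast+
      then show ?thesis by simp
    qed
  qed (use \<phi>(1) \<phi>'(1) quad_if_Q in auto)
  with \<phi>'(2) show False by contradiction
qed

section \<open>The case of two summands\<close>

lemma t_eq_2: "t = 2"
  using t_ge_2 t_less t_not_3 t_not_4 by (auto simp: parity_def split: if_splits)

lemma idx_eq: "idx = {1, 2}"
  unfolding idx_def unfolding t_eq_2 by auto

text \<open>Matches the second summand with \<open>perp B U\<close> in \<open>Gamma_code\<close>. A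
  vector orthogonal to \<open>V 1\<close> has first component orthogonal to \<open>V 1\<close>,
  hence 0.\<close>

lemma V_2_eq_perp: "V 2 = perp B (V 1)"
proof
  show "V 2 \<subseteq> perp B (V 1)"
    using orth_V[of 2 1] by (auto simp: perp_def idx_eq)
  show "perp B (V 1) \<subseteq> V 2"
  proof
    fix x assume x: "x \<in> perp B (V 1)"
    obtain f where f: "\<And>i. i \<in> idx \<Longrightarrow> f i \<in> V i" "x = (\<Sum>i\<in>idx. f i)"
      using components by blast
    have "B (f 1) y = 0" if "y \<in> V 1" for y
      using form_sum_V[of idx f 1 y] f x that by (simp add: perp_def idx_eq)
    then have "f 1 = 0"
      using nondegD[OF nondeg_V, of 1 "f 1"] f(1)[of 1] by (simp add: idx_eq)
    then show "x \<in> V 2"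
      using f by (simp add: idx_eq)
  qed
qed

text \<open>\<open>V 1\<close> is nonzero and proper, so irreducibility provides an element moving
  it, and \<open>V 2\<close> is the only other place.\<close>

lemma exists_swap:
  obtains g \<sigma> where "g \<in> Sp_set_stab B \<Delta>" "\<sigma> 1 = (2::nat)" "\<sigma> 2 = (1::nat)"
    "\<And>\<phi>. quad \<phi> \<Longrightarrow> minus_set (form_act g \<phi>) = \<sigma> ` minus_set \<phi>"
proof -
  have 1: "1 \<in> idx" and 2: "2 \<in> idx"
    by (auto simp: idx_eq)
  have "V 1 \<noteq> {0}"
  proof
    assume "V 1 = {0}"
    then have "card (V 1) = 1" by (simp only: is_singletonI is_singleton_altdef[symmetric])
    then show False
      using card_V[OF 1] by linarith
  qed
  moreover have "V 1 \<noteq> UNIV"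
  proof
    assume "V 1 = UNIV"
    then have "V 2 \<subseteq> {0}"
      unfolding V_2_eq_perp perp_def using nondegD[OF nondeg_UNIV UNIV_I] by blast
    then have "card (V 2) \<le> 1"
      using card_mono[of "{0}" "V 2"] by simp
    then show False
      using card_V[OF 2] by simp
  qed
  ultimately obtain g where g: "g \<in> Sp_set_stab B \<Delta>" "\<not> g ` V 1 \<subseteq> V 1"
    using irreducible nondeg_subspace[OF nondeg_V[OF 1]] unfolding irreducible_on_space_def by blast
  obtain \<sigma> where \<sigma>: "bij_betw \<sigma> idx idx" "\<And>i. i \<in> idx \<Longrightarrow> g ` V i = V (\<sigma> i)"
    "\<And>\<phi>. quad \<phi> \<Longrightarrow> minus_set (form_act g \<phi>) = \<sigma> ` minus_set \<phi>"
    using decomp_stab_permutes[of g] stab_subset g(1) by blast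
  have "\<sigma> 1 \<noteq> 1"
    using \<sigma>(2)[OF 1] g(2) by auto
  then have "\<sigma> 1 = 2" "\<sigma> 2 = 1"
    using \<sigma>(1) unfolding bij_betw_def idx_eq by (auto simp: doubleton_eq_iff)
  then show ?thesis
    using that g(1) \<sigma>(3) by blast
qed

lemma form_act_side:
  assumes "g \<in> Sp_set_stab B \<Delta>"
  shows "form_act g \<phi> \<in> \<Delta> \<longleftrightarrow> \<phi> \<in> \<Delta>"
proof -
  have "g \<in> Sp B" "form_act g ` \<Delta> = \<Delta>"
    using assms by (auto simp: Sp_set_stab_def)
  then show ?thesis
    using inj_image_mem_iff[OF inj_form_act, of g \<phi> \<Delta>] by simp
qed

text \<open>For sign minus the patterns are \<open>{1}\<close> and \<open>{2}\<close>, and the swap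
  puts both on each side. An element fixing a form with pattern \<open>{1}\<close> fixes the index
  1, so it cannot turn \<open>{1}\<close> into \<open>{2}\<close> on the other side.\<close>

lemma sign_eq_Plus: "\<epsilon> = Plus"
proof (rule ccontr)
  assume "\<epsilon> \<noteq> Plus"
  then have p: "parity = 1"
    unfolding parity_def by (cases \<epsilon>) auto
  obtain g \<sigma> where g: "g \<in> Sp_set_stab B \<Delta>" "\<sigma> 1 = (2::nat)" "\<sigma> 2 = (1::nat)"
    "\<And>\<phi>. quad \<phi> \<Longrightarrow> minus_set (form_act g \<phi>) = \<sigma> ` minus_set \<phi>"
    using exists_swap by blast
  have both: "\<exists>\<psi>\<in>Q B \<epsilon>. (\<psi> \<in> \<Delta> \<longleftrightarrow> \<phi> \<in> \<Delta>) \<and> minus_set \<psi> = {i}"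
    if \<phi>: "\<phi> \<in> Q B \<epsilon>" and i: "i \<in> {1, 2}" for \<phi> i
  proof (cases "minus_set \<phi> = {i}")
    case True
    then show ?thesis using \<phi> by blast
  next
    case False
    have "minus_set \<phi> \<in> Pow {1, 2}" "odd (card (minus_set \<phi>))"
      using minus_set_subset[of \<phi>] even_card_minus_set[OF \<phi>] by (auto simp: idx_eq p)
    then have "minus_set \<phi> = {1} \<or> minus_set \<phi> = {2}"
      by (auto simp: Pow_insert)
    then have "i = 1 \<and> minus_set \<phi> = {2} \<or> i = 2 \<and> minus_set \<phi> = {1}"
      using False i by auto
    then have "\<sigma> ` minus_set \<phi> = {i}"
      by (elim disjE conjE) (simp_all only: image_insert image_empty g(2,3))
    moreover have "form_act g \<phi> \<in> Q B \<epsilon>"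
      using g(1) form_act_Q[OF _ \<phi>, of g] by (simp add: Sp_set_stab_def)
    ultimately show ?thesis
      using form_act_side[OF g(1), of \<phi>] g(4) quad_if_Q[OF \<phi>] by metis
  qed
  obtain \<phi>0 where "\<phi>0 \<in> Q B \<epsilon>"
    using opposite_side by blast
  then obtain \<phi> where \<phi>: "\<phi> \<in> Q B \<epsilon>" "minus_set \<phi> = {1}"
    using both[of _ 1] by blast
  obtain \<psi>0 where \<psi>0: "\<psi>0 \<in> Q B \<epsilon>" "\<psi>0 \<in> \<Delta> \<longleftrightarrow> \<phi> \<notin> \<Delta>"
    using opposite_side by blast
  obtain \<psi> where \<psi>: "\<psi> \<in> Q B \<epsilon>" "\<psi> \<in> \<Delta> \<longleftrightarrow> \<psi>0 \<in> \<Delta>" "minus_set \<psi> = {1}"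
    using both[OF \<psi>0(1), of 1] by auto
  obtain \<psi>' where \<psi>': "\<psi>' \<in> Q B \<epsilon>" "\<psi>' \<in> \<Delta> \<longleftrightarrow> \<psi>0 \<in> \<Delta>" "minus_set \<psi>' = {2}"
    using both[OF \<psi>0(1), of 2] by auto
  obtain g' \<sigma>' where "\<sigma>' ` minus_set \<phi> = minus_set \<phi>" "\<sigma>' ` minus_set \<psi> = minus_set \<psi>'"
    using stabiliser_permutation[OF \<phi>(1) \<psi>(1) \<psi>'(1)] \<psi>0(2) \<psi>(2) \<psi>'(2) by metis
  then show False
    using \<phi>(2) \<psi>(3) \<psi>'(3) by simp
qed

lemma O_set_eq: "O_set B \<epsilon> t V m = {\<phi> \<in> Q B \<epsilon>. card (minus_set \<phi>) = m}"
  by (simp add: O_set_def minus_set_def idx_def del: has_type_on.simps)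

text \<open>The patterns \<open>{}\<close> and \<open>{1, 2}\<close> both occur and lie on opposite
  sides because their sizes differ, so size and side determine each other.\<close>

lemma \<Delta>_eq_O_set: "\<Delta> = O_set B \<epsilon> t V 0 \<or> \<Delta> = O_set B \<epsilon> t V 2"
proof -
  have p: "parity = 0"
    unfolding parity_def by (simp add: sign_eq_Plus)
  obtain \<phi> where \<phi>: "\<phi> \<in> Q B \<epsilon>" "minus_set \<phi> = {}"
    using form_with_minus_set[of "{}"] by (auto simp: p)
  obtain \<psi> where \<psi>: "\<psi> \<in> Q B \<epsilon>" "minus_set \<psi> = {1, 2}"
    using form_with_minus_set[of "{1, 2}"] by (auto simp: p idx_eq)
  have side: "\<phi> \<in> \<Delta> \<longleftrightarrow> \<psi> \<notin> \<Delta>"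
    using card_minus_set_eq[OF \<phi>(1) \<psi>(1)] \<phi>(2) \<psi>(2) by auto
  have 0: "card (minus_set \<theta>) = 0 \<longleftrightarrow> (\<theta> \<in> \<Delta> \<longleftrightarrow> \<phi> \<in> \<Delta>)"
    and 2: "card (minus_set \<theta>) = 2 \<longleftrightarrow> (\<theta> \<in> \<Delta> \<longleftrightarrow> \<psi> \<in> \<Delta>)" if "\<theta> \<in> Q B \<epsilon>" for \<theta>
    using card_minus_set_eq[OF that \<phi>(1)] card_minus_set_eq[OF that \<psi>(1)] side \<phi>(2) \<psi>(2) by auto
  show ?thesis
  proof (cases "\<phi> \<in> \<Delta>")
    case True
    then have "\<Delta> = {\<theta> \<in> Q B \<epsilon>. card (minus_set \<theta>) = 0}"
      using 0 \<Delta>_subset by blast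
    then show ?thesis
      unfolding O_set_eq by blast
  next
    case False
    then have "\<Delta> = {\<theta> \<in> Q B \<epsilon>. card (minus_set \<theta>) = 2}"
      using 2 side \<Delta>_subset by blast
    then show ?thesis
      unfolding O_set_eq by blast
  qed
qed

text \<open>Membership in \<open>\<Delta>\<close> depends on the size of the pattern, which the
  decomposition stabiliser preserves; injectivity on a finite set upgrades the inclusion to
  equality.\<close>

lemma stab_eq: "Sp_set_stab B \<Delta> = Sp_decomp_stab B t V"
proof
  show "Sp_decomp_stab B t V \<subseteq> Sp_set_stab B \<Delta>"
  proof
    fix g assume g: "g \<in> Sp_decomp_stab B t V"
    then have gSp: "g \<in> Sp B"
      by (simp add: Sp_decomp_stab_def)
    obtain m where m: "\<Delta> = {\<phi> \<in> Q B \<epsilon>. card (minus_set \<phi>) = m}"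
      using \<Delta>_eq_O_set unfolding O_set_eq by blast
    have "form_act g ` \<Delta> \<subseteq> \<Delta>"
      unfolding m using card_minus_set_form_act[OF g] form_act_Q[OF gSp] quad_if_Q by auto
    then have "form_act g ` \<Delta> = \<Delta>"
      using inj_form_act[OF gSp] by (intro endo_inj_surj) (auto intro: inj_on_subset)
    then show "g \<in> Sp_set_stab B \<Delta>"
      using gSp by (simp add: Sp_set_stab_def)
  qed
qed (rule stab_subset)

end

section \<open>Codes as orbits of the symplectic group\<close>

context symplectic_space
begin

text \<open>The codewords of \<open>Gamma_code\<close> as a function of the subspace, so that the
  group acts through \<open>U\<close>.\<close>

definition codeword :: "sign \<Rightarrow> sign \<Rightarrow> (bit ^ 'm) set \<Rightarrow> (bit ^ 'm \<Rightarrow> bit) set" where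
  "codeword \<epsilon> s U =
     {\<phi> \<in> Q B \<epsilon>. has_type_on \<phi> U s \<and> has_type_on \<phi> (perp B U) (sign_mult \<epsilon> s)}"

lemma form_act_codeword:
  assumes g: "g \<in> Sp B" and U: "nondeg U"
  shows "form_act g ` codeword \<epsilon> s U = codeword \<epsilon> s (g ` U)"
proof -
  have iff: "form_act g \<phi> \<in> codeword \<epsilon> s (g ` U) \<longleftrightarrow> \<phi> \<in> codeword \<epsilon> s U" if "\<phi> \<in> Q B \<epsilon>" for \<phi>
    using that form_act_Q[OF g that] has_type_on_form_act[OF g quad_if_Q[OF that] U]
      has_type_on_form_act[OF g quad_if_Q[OF that] nondeg_perp[OF U]]
    unfolding codeword_def perp_image[OF g] by blast
  \<comment> \<open>Surjectivity on \<open>Q B \<epsilon>\<close> lets every form of the target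
    codeword be written as an image.\<close>
  have "form_act g ` Q B \<epsilon> = Q B \<epsilon>"
    using form_act_Q[OF g] inj_form_act[OF g] by (intro endo_inj_surj) (auto intro: inj_on_subset)
  then have "codeword \<epsilon> s (g ` U) \<subseteq> form_act g ` Q B \<epsilon>"
    by (auto simp: codeword_def)
  moreover have "codeword \<epsilon> s U \<subseteq> Q B \<epsilon>"
    by (auto simp: codeword_def)
  ultimately show ?thesis
    using iff by blast
qed

text \<open>\<open>Sp B\<close> is transitive on nondegenerate subspaces of a given dimension and
  moves codewords along with their subspaces.\<close>

lemma Gamma_code_eq_orbit:
  assumes U: "nondeg U" and dim: "vec.dim U = 2 * d"
  shows "Gamma_code B d \<epsilon> s = (\<lambda>g. form_act g ` codeword \<epsilon> s U) ` Sp B"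
proof -
  have eq: "Gamma_code B d \<epsilon> s = {codeword \<epsilon> s W | W. nondeg W \<and> vec.dim W = 2 * d}"
    by (simp add: Gamma_code_def codeword_def)
  show ?thesis
  proof
    show "Gamma_code B d \<epsilon> s \<subseteq> (\<lambda>g. form_act g ` codeword \<epsilon> s U) ` Sp B"
    proof
      fix C assume "C \<in> Gamma_code B d \<epsilon> s"
      then obtain W where W: "C = codeword \<epsilon> s W" "nondeg W" "vec.dim W = 2 * d"
        by (auto simp: eq)
      then have "card U = card W"
        using dim U by (simp add: card_subspace_bit nondeg_subspace)
      then obtain g where "g \<in> Sp B" "g ` U = W"
        using Sp_transitive_nondeg[OF U W(2)] by blast
      then show "C \<in> (\<lambda>g. form_act g ` codeword \<epsilon> s U) ` Sp B"
        using form_act_codeword[OF _ U] W(1) by auto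
    qed
    show "(\<lambda>g. form_act g ` codeword \<epsilon> s U) ` Sp B \<subseteq> Gamma_code B d \<epsilon> s"
    proof clarify
      fix g assume g: "g \<in> Sp B"
      have nd: "nondeg (g ` U)"
        using nondeg_image[OF g U] .
      have "card (g ` U) = card U"
        using Sp_bij[OF g] by (metis bij_is_inj card_image inj_on_subset subset_UNIV)
      then have "(2::nat) ^ vec.dim (g ` U) = 2 ^ vec.dim U"
        by (simp only: card_subspace_bit[OF nondeg_subspace[OF nd]] card_subspace_bit[OF nondeg_subspace[OF U]])
      then have "vec.dim (g ` U) = 2 * d"
        using dim by simp
      then show "form_act g ` codeword \<epsilon> s U \<in> Gamma_code B d \<epsilon> s"
        unfolding eq form_act_codeword[OF g U] using nd by blast
    qed
  qed
qed

end

context two_orbit_decomposition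
begin

text \<open>For sign plus the two summands have equal types, so the sizes 0 and 2 are the cases of
  two plus and two minus types.\<close>

lemma O_set_eq_codeword:
  shows "O_set B \<epsilon> t V 0 = codeword \<epsilon> Plus (V 1)" and "O_set B \<epsilon> t V 2 = codeword \<epsilon> Minus (V 1)"
proof -
  have 1: "1 \<in> idx" and 2: "2 \<in> idx"
    by (auto simp: idx_eq)
  have el: "i \<in> minus_set \<phi> \<longleftrightarrow> has_type_on \<phi> (V i) Minus" if "i \<in> idx" for i \<phi>
    using that by (simp add: minus_set_def del: has_type_on.simps)
  have card_0: "card (minus_set \<phi>) = 0 \<longleftrightarrow> 1 \<notin> minus_set \<phi> \<and> 2 \<notin> minus_set \<phi>" for \<phi>
    using finite_minus_set[of \<phi>] minus_set_subset[of \<phi>] by (auto simp: idx_eq)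
  have card_2: "card (minus_set \<phi>) = 2 \<longleftrightarrow> 1 \<in> minus_set \<phi> \<and> 2 \<in> minus_set \<phi>" for \<phi>
  proof
    assume "card (minus_set \<phi>) = 2"
    then have "minus_set \<phi> = {1, 2}"
      using minus_set_subset[of \<phi>] by (intro card_subset_eq) (auto simp: idx_eq)
    then show "1 \<in> minus_set \<phi> \<and> 2 \<in> minus_set \<phi>" by simp
  next
    assume "1 \<in> minus_set \<phi> \<and> 2 \<in> minus_set \<phi>"
    then have "minus_set \<phi> = {1, 2}"
      using minus_set_subset[of \<phi>] by (auto simp: idx_eq)
    then show "card (minus_set \<phi>) = 2" by simp
  qed
  have Plus: "has_type_on \<phi> (V i) Plus \<longleftrightarrow> \<not> has_type_on \<phi> (V i) Minus"
    if "i \<in> idx" "\<phi> \<in> Q B \<epsilon>" for i \<phi>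
    using has_type_on_Plus_iff[OF nondeg_V[OF that(1)] quad_if_Q[OF that(2)]] .
  have mult: "sign_mult \<epsilon> s = s" for s
    by (simp add: sign_eq_Plus)
  show "O_set B \<epsilon> t V 0 = codeword \<epsilon> Plus (V 1)"
    unfolding O_set_eq codeword_def V_2_eq_perp[symmetric] mult card_0 el[OF 1] el[OF 2]
    using Plus[OF 1] Plus[OF 2] by blast
  show "O_set B \<epsilon> t V 2 = codeword \<epsilon> Minus (V 1)"
    unfolding O_set_eq codeword_def V_2_eq_perp[symmetric] mult card_2 el[OF 1] el[OF 2] by blast
qed

end

theorem theorem6p4:
  fixes B :: "bit ^ 'm \<Rightarrow> bit ^ 'm \<Rightarrow> bit"
    and n k t :: nat
    and \<epsilon> :: sign
    and \<Gamma> :: "(bit ^ 'm \<Rightarrow> bit) set set"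
    and \<Delta> :: "(bit ^ 'm \<Rightarrow> bit) set"
    and V :: "nat \<Rightarrow> (bit ^ 'm) set"
  assumes "CARD('m) = 2 * n" and "n \<ge> 2"
    and "symplectic_form B"
    and "johnson_code (Q B \<epsilon>) k \<Gamma>"
    and "strongly_incidence_transitive B \<epsilon> \<Gamma>"
    and "\<Delta> \<in> \<Gamma>"
    and "1 < card \<Delta>" and "card \<Delta> < card (Q B \<epsilon>) - 1"
    and "irreducible_on_space (Sp_set_stab B \<Delta>)"
    and "decomposition B n t V"
    and "Sp_set_stab B \<Delta> \<subseteq> Sp_decomp_stab B t V"
  shows "t = 2 \<and>
    (\<epsilon> = Plus \<and> \<Gamma> = Gamma_code B (n div 2) Plus Plus \<and> \<Delta> = O_set B Plus t V 0 \<or>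
     \<epsilon> = Plus \<and> \<Gamma> = Gamma_code B (n div 2) Plus Minus \<and> \<Delta> = O_set B Plus t V 2) \<and>
    Sp_set_stab B \<Delta> = Sp_decomp_stab B t V"
proof -
  interpret two_orbit_decomposition B n t V \<epsilon> \<Delta>
  proof unfold_locales
    show "\<Delta> \<subseteq> Q B \<epsilon>"
      using assms(4,6) by (auto simp: johnson_code_def)
    show "\<exists>g\<in>Sp_set_stab B \<Delta>. form_act g \<phi> = \<phi>' \<and> form_act g \<psi> = \<psi>'"
      if "\<phi> \<in> \<Delta>" "\<psi> \<in> Q B \<epsilon> - \<Delta>" "\<phi>' \<in> \<Delta>" "\<psi>' \<in> Q B \<epsilon> - \<Delta>" for \<phi> \<psi> \<phi>' \<psi>'
    proof -
      have "\<forall>(\<phi>, \<psi>) \<in> \<Delta> \<times> (Q B \<epsilon> - \<Delta>). \<forall>(\<phi>', \<psi>') \<in> \<Delta> \<times> (Q B \<epsilon> - \<Delta>).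
        \<exists>g\<in>Sp_set_stab B \<Delta>. form_act g \<phi> = \<phi>' \<and> form_act g \<psi> = \<psi>'"
        using assms(5) unfolding strongly_incidence_transitive_def
        by (elim conjE) (rule bspec[OF _ assms(6)])
      then show ?thesis
        using that unfolding split_paired_Ball_Sigma prod.case by blast
    qed
  qed (use assms in auto)
  have 1: "1 \<in> idx"
    by (simp add: idx_eq)
  \<comment> \<open>As 2 divides \<open>n\<close>, the dimension \<open>n\<close> of
    \<open>V 1\<close> equals \<open>2 * (n div 2)\<close>.\<close>
  have "even n"
    using assms(10) t_eq_2 by (simp add: decomposition_def)
  then have dim: "vec.dim (V 1) = 2 * (n div 2)"
    using dim_V[OF 1] t_eq_2 by simp
  \<comment> \<open>Invariance of the code gives one inclusion, transitivity on it the
    other.\<close>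
  have \<Gamma>: "\<Gamma> = (\<lambda>g. form_act g ` \<Delta>) ` Sp B"
  proof -
    have inv: "(\<lambda>\<Delta>. form_act g ` \<Delta>) ` \<Gamma> = \<Gamma>" if "g \<in> Sp B" for g
      using assms(5) that unfolding strongly_incidence_transitive_def by simp
    have "\<exists>g\<in>Sp B. form_act g ` \<Delta> = C" if "C \<in> \<Gamma>" for C
      using assms(5,6) that unfolding strongly_incidence_transitive_def by simp
    then show ?thesis
      using inv assms(6) by blast
  qed
  have "\<Gamma> = Gamma_code B (n div 2) \<epsilon> s" if "\<Delta> = codeword \<epsilon> s (V 1)" for s
    unfolding \<Gamma> that by (rule Gamma_code_eq_orbit[OF nondeg_V[OF 1] dim, symmetric])
  then show ?thesis
    using t_eq_2 sign_eq_Plus \<Delta>_eq_O_set O_set_eq_codeword stab_eq by metis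
qed

end
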